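(* Let $\phi:(\mathbb{P}^1)^3\dashrightarrow\mathbb{P}^3$ be a hexahedral trilinear rational map. Then $\phi$ is birational of type $(1,1,1)$ if and only if $$w_{ijk}=\alpha_i\,\beta_j\,\gamma_k\,\Delta_{ijk}\qquad(0\le i,j,k\le1)$$ for some $(\alpha_0:\alpha_1)\times(\beta_0:\beta_1)\times(\gamma_0:\gamma_1)$ in $(\mathbb{P}^1_{\mathbb{R}})^3$.
   Context: Setting. $\mathbb{P}^n$ is complex and $\mathbb{P}^n_{\mathbb{R}}$ real projective $n$-space. $\phi:\mathbb{P}^1\times\mathbb{P}^1\times\mathbb{P}^1\dashrightarrow\mathbb{P}^3$ is the trilinear rational map given by $$\mathbf{f}=(f_0,f_1,f_2,f_3)=\sum_{0\le i,j,k\le 1} w_{ijk}\,\mathbf{P}_{ijk}\,s_it_ju_k,$$ with control points $\mathbf{P}_{ijk}=(1,x_{ijk},y_{ijk},z_{ijk})\in\mathbb{R}^4$ (identified with points of $\mathbb{P}^3$) and weights $w_{ijk}\in\mathbb{R}$. The weights matter only up to a common nonzero scalar, and the equality of weights is understood in this sense (equivalently, for suitable representatives of the points of $\mathbb{P}^1_{\mathbb{R}}$). Boundary surfaces. $\Sigma_0$ (resp. $\Sigma_1$) is the closure of the image of $\phi$ restricted to $(s_0:s_1)=(1:0)$ (resp. $(0:1)$). $T_0,T_1$ and $Y_0,Y_1$ are defined in the same way using $(t_0:t_1)$ and $(u_0:u_1)$. So $\mathbf{P}_{ijk}\in\Sigma_i\cap T_j\cap Y_k$. Boundary lines: $s_{jk}$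 joins $\mathbf{P}_{0jk},\mathbf{P}_{1jk}$; $t_{ik}$ joins $\mathbf{P}_{i0k},\mathbf{P}_{i1k}$; $u_{ij}$ joins $\mathbf{P}_{ij0},\mathbf{P}_{ij1}$ (images of the corresponding coordinate lines). Each boundary surface is a plane or a quadric. Standing nondegeneracy assumption: the surfaces $\Sigma_i,T_j,Y_k$ are smooth surfaces, pairwise distinct, and $s_{jk},t_{ik},u_{ij}$ are lines, pairwise distinct. $\phi$ is hexahedral if all boundary surfaces are planes. Then $\Sigma_i,T_j,Y_k$ are defined by linear forms with coefficient vectors $\boldsymbol{\sigma}_i=(\sigma_{0i},\dots,\sigma_{3i})$, $\boldsymbol{\tau}_j=(\tau_{0j},\dots,\tau_{3j})$, $\boldsymbol{\upsilon}_k=(\upsilon_{0k},\dots,\upsilon_{3k})$ in $\mathbb{R}^4$, and $$\Delta_{ijk}=\begin{vmatrix}\sigma_{1i}&\sigma_{2i}&\sigma_{3i}\\ \tau_{1j}&\tau_{2j}&\tau_{3j}\\ \upsilon_{1k}&\upsilon_{2k}&\upsilon_{3k}\end{vmatrix}\neq0,$$ with $\mathbf{P}_{ijk}=\Delta_{ijk}^{-1}\,\boldsymbol{\sigma}_i\wedge\boldsymbol{\tau}_j\wedge\boldsymbol{\upsilon}_k$ (the triple wedge being identified with a vector of $\mathbb{R}^4$). Type. If $\phi$ is birational, its inverse is $\mathbf{x}\mapsto(A_0:A_1)\times(B_0:B_1)\times(C_0:C_1)$ with $A_0,A_1$ (resp. $B_0,B_1$; $C_0,C_1$) homogeneous of the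 same degree in $\mathbf{x}=(x_0,\dots,x_3)$ without common factor; the type of $\phi$ is $(\deg A_i,\deg B_j,\deg C_k)$. *)

theory Defs
  imports "HOL-Analysis.Analysis"
begin

text \<open>
  Points of the complex projective space of dimension \<open>n\<close> are given by nonzero coordinate vectors
  in \<open>complex ^ (n+1)\<close>, and subsets of projective space by their (scaling-invariant) sets of nonzero
  coordinate vectors. Coordinates are indexed by the numeral types \<open>2\<close> and \<open>4\<close>, whose elements are
  \<open>0, 1\<close> and \<open>0, 1, 2, 3\<close>.
\<close>

definition proj_eq :: "complex ^ 'n \<Rightarrow> complex ^ 'n \<Rightarrow> bool" where
  "proj_eq x y \<longleftrightarrow> x \<noteq> 0 \<and> y \<noteq> 0 \<and> (\<exists>c. y = c *s x)"

definition of_real_vec :: "real ^ 'n \<Rightarrow> complex ^ 'n" where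
  "of_real_vec v = (\<chi> m. complex_of_real (v $ m))"

section \<open>Homogeneous polynomials and the Zariski topology\<close>

text \<open>
  Polynomials over the infinite field \<open>complex\<close> are identified with polynomial functions.
  The zero polynomial is homogeneous of every degree.
\<close>

definition homogeneous_poly :: "nat \<Rightarrow> (complex ^ 'n \<Rightarrow> complex) \<Rightarrow> bool" where
  "homogeneous_poly d F \<longleftrightarrow>
    (\<exists>c :: ('n \<Rightarrow> nat) \<Rightarrow> complex. \<forall>x.
       F x = (\<Sum>e | (\<Sum>i\<in>UNIV. e i) = d. c e * (\<Prod>i\<in>UNIV. (x $ i) ^ e i)))"

definition trihomogeneous_poly ::
    "nat \<Rightarrow> nat \<Rightarrow> nat \<Rightarrow> (complex ^ 2 \<Rightarrow> complex ^ 2 \<Rightarrow> complex ^ 2 \<Rightarrow> complex) \<Rightarrow> bool" where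
  "trihomogeneous_poly a b c G \<longleftrightarrow>
    (\<exists>g :: nat \<Rightarrow> nat \<Rightarrow> nat \<Rightarrow> complex. \<forall>s t u.
       G s t u = (\<Sum>i\<le>a. \<Sum>j\<le>b. \<Sum>k\<le>c. g i j k *
         ((s $ 0) ^ (a - i) * (s $ 1) ^ i) *
         ((t $ 0) ^ (b - j) * (t $ 1) ^ j) *
         ((u $ 0) ^ (c - k) * (u $ 1) ^ k)))"

definition zariski_closed :: "(complex ^ 'n) set \<Rightarrow> bool" where
  "zariski_closed X \<longleftrightarrow>
    (\<exists>S. (\<forall>F\<in>S. \<exists>d. homogeneous_poly d F) \<and> X = {x. x \<noteq> 0 \<and> (\<forall>F\<in>S. F x = 0)})"

definition zariski_open :: "(complex ^ 'n) set \<Rightarrow> bool" where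
  "zariski_open U \<longleftrightarrow> (\<exists>X. zariski_closed X \<and> U = (- {0}) - X)"

definition zariski_closure :: "(complex ^ 'n) set \<Rightarrow> (complex ^ 'n) set" where
  "zariski_closure Z = \<Inter> {X. zariski_closed X \<and> Z \<subseteq> X}"

text \<open>The Zariski topology of a product of three projective lines.\<close>

definition zariski_open3 :: "((complex ^ 2) \<times> (complex ^ 2) \<times> (complex ^ 2)) set \<Rightarrow> bool" where
  "zariski_open3 U \<longleftrightarrow>
    (\<exists>S. (\<forall>G\<in>S. \<exists>a b c. trihomogeneous_poly a b c G) \<and>
         U = {(s, t, u). s \<noteq> 0 \<and> t \<noteq> 0 \<and> u \<noteq> 0 \<and> (\<exists>G\<in>S. G s t u \<noteq> 0)})"

section \<open>Lines, planes and smooth surfaces\<close>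

definition is_line :: "(complex ^ 4) set \<Rightarrow> bool" where
  "is_line X \<longleftrightarrow> (\<exists>V. vec.subspace V \<and> vec.dim V = 2 \<and> X = V - {0})"

definition is_plane :: "(complex ^ 4) set \<Rightarrow> bool" where
  "is_plane X \<longleftrightarrow> (\<exists>V. vec.subspace V \<and> vec.dim V = 3 \<and> X = V - {0})"

definition plane_of :: "real ^ 4 \<Rightarrow> (complex ^ 4) set" where
  "plane_of v = {x. x \<noteq> 0 \<and> (\<Sum>m\<in>UNIV. complex_of_real (v $ m) * x $ m) = 0}"

definition partial_deriv :: "'n \<Rightarrow> (complex ^ 'n \<Rightarrow> complex) \<Rightarrow> complex ^ 'n \<Rightarrow> complex" where
  "partial_deriv i F x = deriv (\<lambda>z. F (x + z *s axis i 1)) 0"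

text \<open>
  Jacobian criterion: surfaces in projective 3-space are hypersurfaces, and an equation whose
  gradient vanishes nowhere on its zero set is automatically reduced.
\<close>

definition smooth_surface :: "(complex ^ 4) set \<Rightarrow> bool" where
  "smooth_surface X \<longleftrightarrow>
    (\<exists>d F. d \<ge> 1 \<and> homogeneous_poly d F \<and> X = {x. x \<noteq> 0 \<and> F x = 0} \<and>
           (\<forall>x\<in>X. \<exists>i. partial_deriv i F x \<noteq> 0))"

section \<open>Trilinear rational maps and their boundary\<close>

definition trilinear_map ::
    "(2 \<Rightarrow> 2 \<Rightarrow> 2 \<Rightarrow> real) \<Rightarrow> (2 \<Rightarrow> 2 \<Rightarrow> 2 \<Rightarrow> real ^ 4) \<Rightarrow>
     complex ^ 2 \<Rightarrow> complex ^ 2 \<Rightarrow> complex ^ 2 \<Rightarrow> complex ^ 4" where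
  "trilinear_map w P s t u =
    (\<Sum>i\<in>UNIV. \<Sum>j\<in>UNIV. \<Sum>k\<in>UNIV.
       (complex_of_real (w i j k) * s $ i * t $ j * u $ k) *s of_real_vec (P i j k))"

text \<open>
  The image of the rational map on \<open>S \<times> T \<times> U\<close>: base points, where all coordinates of the trilinear
  map vanish, are left out.
\<close>

definition image_on ::
    "(2 \<Rightarrow> 2 \<Rightarrow> 2 \<Rightarrow> real) \<Rightarrow> (2 \<Rightarrow> 2 \<Rightarrow> 2 \<Rightarrow> real ^ 4) \<Rightarrow>
     (complex ^ 2) set \<Rightarrow> (complex ^ 2) set \<Rightarrow> (complex ^ 2) set \<Rightarrow> (complex ^ 4) set" where
  "image_on w P S T U =
    {trilinear_map w P s t u | s t u. s \<in> S \<and> t \<in> T \<and> u \<in> U \<and> trilinear_map w P s t u \<noteq> 0}"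

abbreviation proj_line :: "(complex ^ 2) set" where
  "proj_line \<equiv> - {0}"

text \<open>The point \<open>(1:0)\<close> for \<open>i = 0\<close>, and \<open>(0:1)\<close> for \<open>i = 1\<close>.\<close>

definition vertex :: "2 \<Rightarrow> (complex ^ 2) set" where
  "vertex i = {x. proj_eq (axis i 1) x}"

definition Sigma_surface where
  "Sigma_surface w P i = zariski_closure (image_on w P (vertex i) proj_line proj_line)"

definition T_surface where
  "T_surface w P j = zariski_closure (image_on w P proj_line (vertex j) proj_line)"

definition Y_surface where
  "Y_surface w P k = zariski_closure (image_on w P proj_line proj_line (vertex k))"

text \<open>
  The boundary lines are the closures of the images of the coordinate lines. The image of
  \<open>s \<mapsto> (s, j, k)\<close> is spanned by \<open>w 0 j k *\<^sub>R P 0 j k\<close> and \<open>w 1 j k *\<^sub>R P 1 j k\<close>, so it is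
  a line if and only if both weights are nonzero and both points are projectively distinct, in which case it
  is the line joining these points.
\<close>

definition s_line where
  "s_line w P j k = zariski_closure (image_on w P proj_line (vertex j) (vertex k))"

definition t_line where
  "t_line w P i k = zariski_closure (image_on w P (vertex i) proj_line (vertex k))"

definition u_line where
  "u_line w P i j = zariski_closure (image_on w P (vertex i) (vertex j) proj_line)"

definition nondegenerate ::
    "(2 \<Rightarrow> 2 \<Rightarrow> 2 \<Rightarrow> real) \<Rightarrow> (2 \<Rightarrow> 2 \<Rightarrow> 2 \<Rightarrow> real ^ 4) \<Rightarrow> bool" where
  "nondegenerate w P \<longleftrightarrow>
    (\<forall>i. smooth_surface (Sigma_surface w P i)) \<and>
    (\<forall>j. smooth_surface (T_surface w P j)) \<and>
    (\<forall>k. smooth_surface (Y_surface w P k)) \<and>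
    distinct [Sigma_surface w P 0, Sigma_surface w P 1, T_surface w P 0, T_surface w P 1,
              Y_surface w P 0, Y_surface w P 1] \<and>
    (\<forall>j k. is_line (s_line w P j k)) \<and>
    (\<forall>i k. is_line (t_line w P i k)) \<and>
    (\<forall>i j. is_line (u_line w P i j)) \<and>
    distinct [s_line w P 0 0, s_line w P 0 1, s_line w P 1 0, s_line w P 1 1,
              t_line w P 0 0, t_line w P 0 1, t_line w P 1 0, t_line w P 1 1,
              u_line w P 0 0, u_line w P 0 1, u_line w P 1 0, u_line w P 1 1]"

definition hexahedral ::
    "(2 \<Rightarrow> 2 \<Rightarrow> 2 \<Rightarrow> real) \<Rightarrow> (2 \<Rightarrow> 2 \<Rightarrow> 2 \<Rightarrow> real ^ 4) \<Rightarrow> bool" where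
  "hexahedral w P \<longleftrightarrow>
    (\<forall>i. is_plane (Sigma_surface w P i)) \<and>
    (\<forall>j. is_plane (T_surface w P j)) \<and>
    (\<forall>k. is_plane (Y_surface w P k))"

definition Delta :: "real ^ 4 \<Rightarrow> real ^ 4 \<Rightarrow> real ^ 4 \<Rightarrow> real" where
  "Delta a b c =
    det (vector [vector [a $ 1, a $ 2, a $ 3],
                 vector [b $ 1, b $ 2, b $ 3],
                 vector [c $ 1, c $ 2, c $ 3]] :: real ^ 3 ^ 3)"

section \<open>Birationality and type\<close>

text \<open>
  Factors of nonzero homogeneous polynomials are homogeneous, so only homogeneous common factors
  need to be excluded.
\<close>

definition homogeneous_dvd :: "(complex ^ 'n \<Rightarrow> complex) \<Rightarrow> (complex ^ 'n \<Rightarrow> complex) \<Rightarrow> bool" where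
  "homogeneous_dvd H F \<longleftrightarrow> (\<exists>d Q. homogeneous_poly d Q \<and> (\<forall>x. F x = H x * Q x))"

definition coprime_pair :: "nat \<Rightarrow> (complex ^ 4 \<Rightarrow> complex ^ 2) \<Rightarrow> bool" where
  "coprime_pair d A \<longleftrightarrow>
    (\<forall>i. homogeneous_poly d (\<lambda>x. A x $ i)) \<and>
    \<not> (\<exists>e H. e \<ge> 1 \<and> homogeneous_poly e H \<and> (\<forall>i. homogeneous_dvd H (\<lambda>x. A x $ i)))"

text \<open>
  Both compositions are defined and equal to the identity on nonempty (hence dense) Zariski open
  sets. \<open>A\<close>, \<open>B\<close>, \<open>C\<close> stand for the pairs \<open>(A\<^sub>0, A\<^sub>1)\<close>, \<open>(B\<^sub>0, B\<^sub>1)\<close>, \<open>(C\<^sub>0, C\<^sub>1)\<close>.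
\<close>

definition rational_inverse ::
    "(complex ^ 2 \<Rightarrow> complex ^ 2 \<Rightarrow> complex ^ 2 \<Rightarrow> complex ^ 4) \<Rightarrow>
     (complex ^ 4 \<Rightarrow> complex ^ 2) \<Rightarrow> (complex ^ 4 \<Rightarrow> complex ^ 2) \<Rightarrow> (complex ^ 4 \<Rightarrow> complex ^ 2) \<Rightarrow>
     bool" where
  "rational_inverse f A B C \<longleftrightarrow>
    (\<exists>U. zariski_open3 U \<and> U \<noteq> {} \<and>
       (\<forall>(s, t, u)\<in>U. f s t u \<noteq> 0 \<and>
          proj_eq s (A (f s t u)) \<and> proj_eq t (B (f s t u)) \<and> proj_eq u (C (f s t u)))) \<and>
    (\<exists>V. zariski_open V \<and> V \<noteq> {} \<and>
       (\<forall>x\<in>V. A x \<noteq> 0 \<and> B x \<noteq> 0 \<and> C x \<noteq> 0 \<and> proj_eq x (f (A x) (B x) (C x))))"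

definition birational_of_type ::
    "(complex ^ 2 \<Rightarrow> complex ^ 2 \<Rightarrow> complex ^ 2 \<Rightarrow> complex ^ 4) \<Rightarrow> nat \<times> nat \<times> nat \<Rightarrow> bool" where
  "birational_of_type f = (\<lambda>(a, b, c).
    \<exists>A B C. coprime_pair a A \<and> coprime_pair b B \<and> coprime_pair c C \<and> rational_inverse f A B C)"

end

theory Submission
  imports Defs "HOL-Computational_Algebra.Polynomial"
begin

text \<open>
  Let \<open>v = w / \<Delta>\<close>, so that \<open>w i j k\<close> times the control point is \<open>v i j k\<close> times
  \<open>\<sigma> i \<and> \<tau> j \<and> \<upsilon> k\<close>. If \<open>v\<close> is a product \<open>\<alpha> i * \<beta> j * \<gamma> k\<close>, then the
  trilinear map is the intersection point of one plane from each of the pencils spanned by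
  \<open>\<sigma> 0, \<sigma> 1\<close>, by \<open>\<tau> 0, \<tau> 1\<close> and by \<open>\<upsilon> 0, \<upsilon> 1\<close>, and the inverse sends a point to
  the three planes through it, which are linear in the point. Conversely, a linear inverse \<open>(A\<^sub>0, A\<^sub>1)\<close>
  in the first factor satisfies \<open>s\<^sub>1 A\<^sub>0(f) = s\<^sub>0 A\<^sub>1(f)\<close>. Restricting to the boundary shows that
  \<open>A\<^sub>0, A\<^sub>1\<close> are multiples of \<open>\<sigma> 1, \<sigma> 0\<close>, and the coefficient of \<open>s\<^sub>0 s\<^sub>1 t\<^sub>j u\<^sub>k\<close> shows that
  \<open>v 1 j k / v 0 j k\<close> does not depend on \<open>j\<close> and \<open>k\<close>; the same holds for the other two factors.
\<close>

notation scalar_product (infixl "\<odot>" 70)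

section \<open>Numeral index types enumerated from 0\<close>

lemma exhaust_2_from_0: "x = 0 \<or> x = 1" for x :: 2
  using exhaust_2[of x] by auto

lemma exhaust_4_from_0: "x = 0 \<or> x = 1 \<or> x = 2 \<or> x = 3" for x :: 4
  using exhaust_4[of x] by auto

lemma UNIV_2_from_0: "(UNIV :: 2 set) = {0, 1}"
  using exhaust_2_from_0 by blast

lemma UNIV_4_from_0: "(UNIV :: 4 set) = {0, 1, 2, 3}"
  using exhaust_4_from_0 by blast

lemma all_2_from_0: "(\<forall>i::2. Q i) \<longleftrightarrow> Q 0 \<and> Q 1"
  unfolding ball_UNIV[of Q, symmetric] UNIV_2_from_0 by simp

lemma all_4_from_0: "(\<forall>i::4. Q i) \<longleftrightarrow> Q 0 \<and> Q 1 \<and> Q 2 \<and> Q 3"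
  unfolding ball_UNIV[of Q, symmetric] UNIV_4_from_0 by simp

lemma sum_2_from_0: "sum f (UNIV :: 2 set) = f 0 + f 1"
  unfolding UNIV_2_from_0 by simp

lemma sum_4_from_0: "sum f (UNIV :: 4 set) = f 0 + f 1 + f 2 + f 3"
  unfolding UNIV_4_from_0 by (simp add: add.assoc)

section \<open>Triple wedge products\<close>

definition minor3 :: "'a::comm_ring_1 ^ 4 \<Rightarrow> 'a ^ 4 \<Rightarrow> 'a ^ 4 \<Rightarrow> 4 \<Rightarrow> 4 \<Rightarrow> 4 \<Rightarrow> 'a" where
  "minor3 a b c l m n =
    a $ l * (b $ m * c $ n - b $ n * c $ m) - a $ m * (b $ l * c $ n - b $ n * c $ l) +
    a $ n * (b $ l * c $ m - b $ m * c $ l)"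

text \<open>The coordinates are the cofactors of the first row in the 4 by 4 determinant with rows
  \<open>x\<close>, \<open>a\<close>, \<open>b\<close>, \<open>c\<close>, so
  \<open>x \<odot> wedge a b c\<close> is this determinant. Orthogonality, cyclic symmetry and the
  swap rule below are its usual row properties.\<close>

definition wedge :: "'a::comm_ring_1 ^ 4 \<Rightarrow> 'a ^ 4 \<Rightarrow> 'a ^ 4 \<Rightarrow> 'a ^ 4" where
  "wedge a b c =
    (\<chi> m. if m = 0 then minor3 a b c 1 2 3 else if m = 1 then - minor3 a b c 0 2 3
          else if m = 2 then minor3 a b c 0 1 3 else - minor3 a b c 0 1 2)"

lemma wedge_nth:
  "wedge a b c $ 0 = minor3 a b c 1 2 3" "wedge a b c $ 1 = - minor3 a b c 0 2 3"
  "wedge a b c $ 2 = minor3 a b c 0 1 3" "wedge a b c $ 3 = - minor3 a b c 0 1 2"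
  by (simp_all add: wedge_def)

lemma scalar_product_4:
  fixes a x :: "'a::comm_ring_1 ^ 4"
  shows "a \<odot> x = a $ 0 * x $ 0 + a $ 1 * x $ 1 + a $ 2 * x $ 2 + a $ 3 * x $ 3"
  by (simp add: scalar_product_def sum_4_from_0)

lemma scalar_product_linear:
  fixes a x y :: "'a::comm_ring_1 ^ 'n"
  shows "a \<odot> (x + y) = a \<odot> x + a \<odot> y" "a \<odot> (x - y) = a \<odot> x - a \<odot> y" "a \<odot> (r *s x) = r * (a \<odot> x)"
    "(x + y) \<odot> a = x \<odot> a + y \<odot> a" "(x - y) \<odot> a = x \<odot> a - y \<odot> a" "(r *s x) \<odot> a = r * (x \<odot> a)"
    "a \<odot> 0 = 0"
  by (simp_all add: scalar_product_def algebra_simps sum.distrib sum_subtractf sum_distrib_left)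

lemma scalar_product_minus:
  fixes a x :: "'a::comm_ring_1 ^ 'n"
  shows "(- x) \<odot> a = - (x \<odot> a)"
  by (simp add: scalar_product_def sum_negf)

lemma scalar_product_sum:
  fixes a :: "'a::comm_ring_1 ^ 'n"
  shows "a \<odot> sum g I = (\<Sum>i\<in>I. a \<odot> g i)"
  by (induction I rule: infinite_finite_induct) (simp_all add: scalar_product_linear)

lemma wedge_orthogonal:
  "a \<odot> wedge a b c = 0" "b \<odot> wedge a b c = 0" "c \<odot> wedge a b c = 0"
  by (simp_all add: scalar_product_4 wedge_nth minor3_def algebra_simps)

lemma wedge_cyclic: "wedge b c a = wedge a b c"
  by (simp add: vec_eq_iff all_4_from_0 wedge_nth minor3_def algebra_simps)

lemma scalar_product_wedge_swap: "b \<odot> wedge a c d = - (a \<odot> wedge b c d)"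
  by (simp add: scalar_product_4 wedge_nth minor3_def algebra_simps)

lemma wedge_linear_left:
  "wedge (a + b) c d = wedge a c d + wedge b c d" "wedge (r *s a) c d = r *s wedge a c d"
  by (simp_all add: vec_eq_iff all_4_from_0 wedge_nth minor3_def algebra_simps)

lemma wedge_linear:
  "wedge (a + b) c d = wedge a c d + wedge b c d"
  "wedge c (a + b) d = wedge c a d + wedge c b d"
  "wedge c d (a + b) = wedge c d a + wedge c d b"
  "wedge (r *s a) c d = r *s wedge a c d"
  "wedge c (r *s a) d = r *s wedge c a d"
  "wedge c d (r *s a) = r *s wedge c d a"
proof -
  have "wedge c x d = wedge x d c" "wedge c d x = wedge x c d" for x
    by (simp_all only: wedge_cyclic)
  note * = this[of "a + b"] this[of a] this[of b] this[of "r *s a"]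
  show "wedge (a + b) c d = wedge a c d + wedge b c d" "wedge (r *s a) c d = r *s wedge a c d"
    "wedge c (a + b) d = wedge c a d + wedge c b d" "wedge c (r *s a) d = r *s wedge c a d"
    "wedge c d (a + b) = wedge c d a + wedge c d b" "wedge c d (r *s a) = r *s wedge c d a"
    unfolding * by (rule wedge_linear_left)+
qed

text \<open>A Cramer rule without division: every 2 by 2 minor of the pair formed by the wedge and
  \<open>x\<close> is a combination \<open>?D\<close> of the three products with \<open>x\<close>,
  whose coefficients are 2 by 2 minors of \<open>a\<close>, \<open>b\<close>, \<open>c\<close>. It
  also covers a vanishing wedge.\<close>

lemma wedge_collinear:
  fixes x :: "'a::comm_ring_1 ^ 4"
  assumes "a \<odot> x = 0" "b \<odot> x = 0" "c \<odot> x = 0"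
  shows "x $ n *s wedge a b c = wedge a b c $ n *s x"
proof -
  let ?W = "wedge a b c"
  let ?D = "\<lambda>p q. (a \<odot> x) * (b $ p * c $ q - b $ q * c $ p) - (b \<odot> x) * (a $ p * c $ q - a $ q * c $ p) +
    (c \<odot> x) * (a $ p * b $ q - a $ q * b $ p)"
  have "?W $ 0 * x $ 1 - ?W $ 1 * x $ 0 = ?D 2 3" "?W $ 2 * x $ 0 - ?W $ 0 * x $ 2 = ?D 1 3"
    "?W $ 0 * x $ 3 - ?W $ 3 * x $ 0 = ?D 1 2" "?W $ 1 * x $ 2 - ?W $ 2 * x $ 1 = ?D 0 3"
    "?W $ 3 * x $ 1 - ?W $ 1 * x $ 3 = ?D 0 2" "?W $ 2 * x $ 3 - ?W $ 3 * x $ 2 = ?D 0 1"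
    by (simp_all add: scalar_product_4 wedge_nth minor3_def algebra_simps)
  then have "\<forall>n m. x $ n * ?W $ m = ?W $ n * x $ m"
    using assms by (simp add: all_4_from_0 mult.commute)
  then show ?thesis
    by (simp add: vec_eq_iff)
qed

section \<open>Homogeneous and trihomogeneous polynomials\<close>

lemma finite_exponents: "finite {e :: 'n::finite \<Rightarrow> nat. (\<Sum>i\<in>UNIV. e i) = d}"
proof (rule finite_subset)
  show "{e :: 'n \<Rightarrow> nat. (\<Sum>i\<in>UNIV. e i) = d} \<subseteq> PiE UNIV (\<lambda>_. {..d})"
    by (auto simp: PiE_def) (metis finite_code member_le_sum UNIV_I zero_le)
qed (auto intro: finite_PiE)

lemma homogeneous_poly_monomial:
  "(\<Sum>i\<in>UNIV. e i) = d \<Longrightarrow> homogeneous_poly d (\<lambda>x. r * (\<Prod>i\<in>UNIV. (x $ i) ^ e i))"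
  unfolding homogeneous_poly_def
  by (rule exI[of _ "\<lambda>e'. if e' = e then r else 0"])
     (simp add: if_distrib[of "\<lambda>z. z * _"] finite_exponents cong: if_cong)

lemma homogeneous_poly_zero: "homogeneous_poly d (\<lambda>x. 0)"
  unfolding homogeneous_poly_def by (rule exI[of _ "\<lambda>_. 0"]) simp

lemma homogeneous_poly_add:
  "homogeneous_poly d F \<Longrightarrow> homogeneous_poly d G \<Longrightarrow> homogeneous_poly d (\<lambda>x. F x + G x)"
  unfolding homogeneous_poly_def
  by (elim exE, rule_tac x = "\<lambda>e. c e + ca e" in exI) (simp add: algebra_simps sum.distrib)

lemma homogeneous_poly_sum:
  "(\<And>i. i \<in> I \<Longrightarrow> homogeneous_poly d (F i)) \<Longrightarrow> homogeneous_poly d (\<lambda>x. \<Sum>i\<in>I. F i x)"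
  by (induction I rule: infinite_finite_induct)
     (simp_all add: homogeneous_poly_zero homogeneous_poly_add)

lemma homogeneous_poly_mult:
  assumes "homogeneous_poly d F" "homogeneous_poly d' G"
  shows "homogeneous_poly (d + d') (\<lambda>x. F x * G x)"
proof -
  obtain f g where
    F: "\<And>x. F x = (\<Sum>e | (\<Sum>i\<in>UNIV. e i) = d. f e * (\<Prod>i\<in>UNIV. (x $ i) ^ e i))" and
    G: "\<And>x. G x = (\<Sum>e | (\<Sum>i\<in>UNIV. e i) = d'. g e * (\<Prod>i\<in>UNIV. (x $ i) ^ e i))"
    using assms unfolding homogeneous_poly_def by blast
  have "homogeneous_poly (d + d') (\<lambda>x. f e * (\<Prod>i\<in>UNIV. (x $ i) ^ e i) *
      (g e' * (\<Prod>i\<in>UNIV. (x $ i) ^ e' i)))"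
    if "(\<Sum>i\<in>UNIV. e i) = d" "(\<Sum>i\<in>UNIV. e' i) = d'" for e e' :: "'a \<Rightarrow> nat"
    using homogeneous_poly_monomial[of "\<lambda>i. e i + e' i" "d + d'" "f e * g e'"] that
    by (simp add: sum.distrib power_add prod.distrib mult_ac)
  then show ?thesis
    unfolding F G sum_product by (intro homogeneous_poly_sum) auto
qed

lemma homogeneous_poly_scaling:
  assumes "homogeneous_poly d F"
  shows "F (z *s x) = z ^ d * F x"
proof -
  obtain f where
    F: "\<And>x. F x = (\<Sum>e | (\<Sum>i\<in>UNIV. e i) = d. f e * (\<Prod>i\<in>UNIV. (x $ i) ^ e i))"
    using assms unfolding homogeneous_poly_def by blast
  show ?thesis
    unfolding F sum_distrib_left
    by (intro sum.cong refl) (auto simp: power_mult_distrib prod.distrib power_sum mult_ac)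
qed

text \<open>The exponents of total degree 1 are exactly the unit exponents
  \<open>?\<delta> m\<close>, so the sum over exponents can be reindexed by the coordinates.\<close>

lemma homogeneous_poly_1_iff:
  "homogeneous_poly 1 F \<longleftrightarrow> (\<exists>a. F = (\<lambda>x. a \<odot> x))"
proof
  let ?\<delta> = "\<lambda>m i :: 'a. if i = m then 1 else 0 :: nat"
  let ?E = "{e :: 'a \<Rightarrow> nat. (\<Sum>i\<in>UNIV. e i) = 1}"
  have power_\<delta>: "(\<Prod>i\<in>UNIV. (x $ i) ^ ?\<delta> m i) = x $ m" for m and x :: "complex ^ 'a"
    by (simp add: if_distrib[of "\<lambda>z. _ ^ z"] cong: if_cong)
  have E: "?E = range ?\<delta>"
  proof (intro equalityI subsetI)
    fix e assume "e \<in> ?E"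
    then have sum_e: "(\<Sum>i\<in>UNIV. e i) = 1" by simp
    then obtain m where m: "e m = 1" "\<forall>i\<in>UNIV. i \<noteq> m \<longrightarrow> e i = 0"
      using sum_eq_1_iff[of UNIV e] by auto
    have "e = ?\<delta> m"
      using m by auto
    then show "e \<in> range ?\<delta>" by blast
  qed auto
  have inj: "inj ?\<delta>"
    by (rule injI) (auto simp: fun_eq_iff split: if_splits)
  {
    assume "homogeneous_poly 1 F"
    then obtain c where "\<And>x. F x = (\<Sum>e\<in>?E. c e * (\<Prod>i\<in>UNIV. (x $ i) ^ e i))"
      unfolding homogeneous_poly_def by blast
    then have "F x = (\<Sum>m\<in>UNIV. c (?\<delta> m) * x $ m)" for x
      unfolding E by (subst (asm) sum.reindex[OF inj]) (simp add: power_\<delta>)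
    then have "F = (\<lambda>x. (\<chi> m. c (?\<delta> m)) \<odot> x)"
      by (intro ext) (simp add: scalar_product_def)
    then show "\<exists>a. F = (\<lambda>x. a \<odot> x)" by blast
  }
  assume "\<exists>a. F = (\<lambda>x. a \<odot> x)"
  then obtain a where F: "F = (\<lambda>x. \<Sum>m\<in>UNIV. a $ m * x $ m)"
    unfolding scalar_product_def by blast
  have "homogeneous_poly 1 (\<lambda>x :: complex ^ 'a. a $ m * x $ m)" for m
    using homogeneous_poly_monomial[of "?\<delta> m" 1 "a $ m"] unfolding power_\<delta> by simp
  then show "homogeneous_poly 1 F"
    unfolding F by (intro homogeneous_poly_sum)
qed

lemma homogeneous_poly_linear: "homogeneous_poly 1 (\<lambda>x. a \<odot> x)"
  using homogeneous_poly_1_iff by blast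

lemma sum_if_const: "(\<Sum>y\<in>B. if Q then f y else 0) = (if Q then sum f B else 0)"
  by simp

lemma trihomogeneous_poly_monomial:
  assumes "i \<le> a" "j \<le> b" "k \<le> c"
  shows "trihomogeneous_poly a b c (\<lambda>s t u. r *
    ((s $ 0) ^ (a - i) * (s $ 1) ^ i) * ((t $ 0) ^ (b - j) * (t $ 1) ^ j) *
    ((u $ 0) ^ (c - k) * (u $ 1) ^ k))"
  unfolding trihomogeneous_poly_def
  by (rule exI[of _ "\<lambda>i' j' k'. if i' = i then if j' = j then if k' = k then r else 0 else 0 else 0"])
     (simp add: if_distrib[of "\<lambda>z. z * _"] sum_if_const assms cong: if_cong)

lemma trihomogeneous_poly_zero: "trihomogeneous_poly a b c (\<lambda>s t u. 0)"
  unfolding trihomogeneous_poly_def by (rule exI[of _ "\<lambda>_ _ _. 0"]) simp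

lemma trihomogeneous_poly_add:
  "trihomogeneous_poly a b c F \<Longrightarrow> trihomogeneous_poly a b c G \<Longrightarrow>
    trihomogeneous_poly a b c (\<lambda>s t u. F s t u + G s t u)"
  unfolding trihomogeneous_poly_def
  by (elim exE, rule_tac x = "\<lambda>i j k. g i j k + ga i j k" in exI)
     (simp add: algebra_simps sum.distrib)

lemma trihomogeneous_poly_sum:
  "(\<And>i. i \<in> I \<Longrightarrow> trihomogeneous_poly a b c (F i)) \<Longrightarrow>
    trihomogeneous_poly a b c (\<lambda>s t u. \<Sum>i\<in>I. F i s t u)"
  by (induction I rule: infinite_finite_induct)
     (simp_all add: trihomogeneous_poly_zero trihomogeneous_poly_add)

lemma trihomogeneous_poly_mult:
  assumes "trihomogeneous_poly a b c F" "trihomogeneous_poly a' b' c' G"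
  shows "trihomogeneous_poly (a + a') (b + b') (c + c') (\<lambda>s t u. F s t u * G s t u)"
proof -
  let ?m = "\<lambda>a b c i j k r (s :: complex ^ 2) (t :: complex ^ 2) (u :: complex ^ 2). r *
    ((s $ 0) ^ (a - i) * (s $ 1) ^ i) * ((t $ 0) ^ (b - j) * (t $ 1) ^ j) *
    ((u $ 0) ^ (c - k) * (u $ 1) ^ k)"
  obtain f g where
    F: "\<And>s t u. F s t u = (\<Sum>i\<le>a. \<Sum>j\<le>b. \<Sum>k\<le>c. ?m a b c i j k (f i j k) s t u)" and
    G: "\<And>s t u. G s t u = (\<Sum>i\<le>a'. \<Sum>j\<le>b'. \<Sum>k\<le>c'. ?m a' b' c' i j k (g i j k) s t u)"
    using assms unfolding trihomogeneous_poly_def by blast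
  have mono: "trihomogeneous_poly (a + a') (b + b') (c + c')
      (\<lambda>s t u. ?m a b c i j k (f i j k) s t u * ?m a' b' c' i' j' k' (g i' j' k') s t u)"
    if "i \<le> a" "j \<le> b" "k \<le> c" "i' \<le> a'" "j' \<le> b'" "k' \<le> c'" for i j k i' j' k'
  proof -
    \<comment> \<open>Subtraction is truncated; the complementary exponents add up because each
      index stays within its degree.\<close>
    have *: "a + a' - (i + i') = (a - i) + (a' - i')" "b + b' - (j + j') = (b - j) + (b' - j')"
      "c + c' - (k + k') = (c - k) + (c' - k')"
      using that by auto
    show ?thesis
      using trihomogeneous_poly_monomial[of "i + i'" "a + a'" "j + j'" "b + b'" "k + k'" "c + c'"
          "f i j k * g i' j' k'"] that
      unfolding * power_add by (simp add: mult_ac)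
  qed
  show ?thesis
    unfolding F G sum_distrib_left sum_distrib_right
    by (intro trihomogeneous_poly_sum mono) auto
qed

section \<open>Restriction to lines and density of nonempty open sets\<close>

text \<open>Passing to formal polynomials makes it available that a product vanishing at every
  complex number has a zero factor.\<close>

definition polynomial_map :: "(complex \<Rightarrow> complex) \<Rightarrow> bool" where
  "polynomial_map g \<longleftrightarrow> (\<exists>p. \<forall>z. g z = poly p z)"

lemma polynomial_map_intros:
  "polynomial_map (\<lambda>z. r)" "polynomial_map (\<lambda>z. r + z * q)"
  "polynomial_map g \<Longrightarrow> polynomial_map h \<Longrightarrow> polynomial_map (\<lambda>z. g z + h z)"
  "polynomial_map g \<Longrightarrow> polynomial_map h \<Longrightarrow> polynomial_map (\<lambda>z. g z * h z)"
  "polynomial_map g \<Longrightarrow> polynomial_map (\<lambda>z. g z ^ n)"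
proof -
  have "\<forall>z. r = poly [:r:] z" "\<forall>z. r + z * q = poly [:r, q:] z" by auto
  then show "polynomial_map (\<lambda>z. r)" "polynomial_map (\<lambda>z. r + z * q)"
    unfolding polynomial_map_def by blast+
qed (auto simp: polynomial_map_def simp flip: poly_add poly_mult poly_power)

lemma polynomial_map_sum:
  "(\<And>i. i \<in> I \<Longrightarrow> polynomial_map (g i)) \<Longrightarrow> polynomial_map (\<lambda>z. \<Sum>i\<in>I. g i z)"
  by (induction I rule: infinite_finite_induct) (simp_all add: polynomial_map_intros)

lemma trihomogeneous_poly_on_line:
  assumes "trihomogeneous_poly a b c G"
  shows "polynomial_map (\<lambda>z. G (s + z *s s') (t + z *s t') (u + z *s u'))"
proof -
  obtain g where G: "\<And>s t u. G s t u = (\<Sum>i\<le>a. \<Sum>j\<le>b. \<Sum>k\<le>c. g i j k *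
         ((s $ 0) ^ (a - i) * (s $ 1) ^ i) *
         ((t $ 0) ^ (b - j) * (t $ 1) ^ j) *
         ((u $ 0) ^ (c - k) * (u $ 1) ^ k))"
    using assms unfolding trihomogeneous_poly_def by blast
  show ?thesis
    unfolding G vector_add_component vector_smult_component
    by (intro polynomial_map_sum polynomial_map_intros)
qed

text \<open>
  On the line from a point of \<open>U\<close> to an arbitrary point, \<open>U\<close> contains all but finitely many points.
\<close>

lemma zariski_open3_dense:
  assumes U: "zariski_open3 U" "U \<noteq> {}"
    and H: "trihomogeneous_poly a b c H" "\<And>s t u. (s, t, u) \<in> U \<Longrightarrow> H s t u = 0"
  shows "H s t u = 0"
proof -
  obtain S where S: "\<And>G. G \<in> S \<Longrightarrow> \<exists>a b c. trihomogeneous_poly a b c G"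
    and U_eq: "U = {(s, t, u). s \<noteq> 0 \<and> t \<noteq> 0 \<and> u \<noteq> 0 \<and> (\<exists>G\<in>S. G s t u \<noteq> 0)}"
    using U(1) unfolding zariski_open3_def by blast
  obtain s0 t0 u0 G where p0: "s0 \<noteq> 0" "t0 \<noteq> 0" "u0 \<noteq> 0" "G \<in> S" "G s0 t0 u0 \<noteq> 0"
    using U(2) unfolding U_eq by auto
  \<comment> \<open>These coordinates keep the three points nonzero for all but finitely many
    \<open>z\<close>, since the zero vectors are excluded from projective space.\<close>
  obtain l m n where lmn: "s0 $ l \<noteq> 0" "t0 $ m \<noteq> 0" "u0 $ n \<noteq> 0"
    using p0(1-3) by (metis vec_eq_iff zero_index)
  let ?s = "\<lambda>z. s0 + z *s (s - s0)" and ?t = "\<lambda>z. t0 + z *s (t - t0)"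
    and ?u = "\<lambda>z. u0 + z *s (u - u0)"
  obtain p where p: "\<And>z. H (?s z) (?t z) (?u z) = poly p z"
    using trihomogeneous_poly_on_line[OF H(1)] unfolding polynomial_map_def by blast
  obtain q where q: "\<And>z. G (?s z) (?t z) (?u z) = poly q z"
    using S[OF p0(4)] trihomogeneous_poly_on_line unfolding polynomial_map_def by blast
  have *: "polynomial_map (\<lambda>z. ?s z $ l * ?t z $ m * ?u z $ n)"
    unfolding vector_add_component vector_smult_component by (intro polynomial_map_intros)
  obtain r where r: "\<And>z. ?s z $ l * ?t z $ m * ?u z $ n = poly r z"
    using * unfolding polynomial_map_def by blast
  \<comment> \<open>Where \<open>r\<close> and \<open>q\<close> do not vanish the point of the line
    is in \<open>U\<close>, so \<open>p\<close> vanishes there. The factors \<open>r\<close> and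
    \<open>q\<close> are nonzero at \<open>z = 0\<close>, hence \<open>p\<close> is the zero
    polynomial; \<open>z = 1\<close> is the arbitrary point.\<close>
  have "poly (r * q * p) z = 0" for z
  proof (cases "poly r z = 0 \<or> poly q z = 0")
    case False
    then have "?s z $ l * ?t z $ m * ?u z $ n \<noteq> 0" and G: "G (?s z) (?t z) (?u z) \<noteq> 0"
      unfolding q r by auto
    then have "?s z \<noteq> 0" "?t z \<noteq> 0" "?u z \<noteq> 0"
      by (metis mult_zero_left mult_zero_right zero_index)+
    then have "(?s z, ?t z, ?u z) \<in> U"
      using p0(4) G unfolding U_eq by blast
    then have "H (?s z) (?t z) (?u z) = 0"
      by (rule H(2))
    then show ?thesis
      unfolding p by simp
  qed auto
  then have "r * q * p = 0"
    unfolding poly_all_0_iff_0[symmetric] by blast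
  moreover have "poly r 0 \<noteq> 0" "poly q 0 \<noteq> 0"
    using lmn p0(5) unfolding r[symmetric] q[symmetric] by simp_all
  then have "r \<noteq> 0" "q \<noteq> 0" by auto
  ultimately have "p = 0"
    by simp
  then show ?thesis
    using p[of 1] by simp
qed

section \<open>Closures, lines and planes\<close>

lemma zariski_closure_least: "zariski_closed X \<Longrightarrow> Z \<subseteq> X \<Longrightarrow> zariski_closure Z \<subseteq> X"
  unfolding zariski_closure_def by blast

lemma zariski_closure_superset: "Z \<subseteq> zariski_closure Z"
  unfolding zariski_closure_def by blast

lemma zariski_closure_mono: "Y \<subseteq> Z \<Longrightarrow> zariski_closure Y \<subseteq> zariski_closure Z"
  unfolding zariski_closure_def by blast

lemma zariski_closed_linear: "zariski_closed {x. x \<noteq> 0 \<and> (\<forall>a\<in>L. a \<odot> x = 0)}"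
  unfolding zariski_closed_def
  by (rule exI[of _ "(\<lambda>a x. a \<odot> x) ` L"]) (use homogeneous_poly_linear in blast)

lemma is_plane_subset_eq:
  assumes "is_plane A" "is_plane B" "A \<subseteq> B"
  shows "A = B"
proof -
  obtain V W where V: "vec.subspace V" "vec.dim V = 3" "A = V - {0}"
    and W: "vec.subspace W" "vec.dim W = 3" "B = W - {0}"
    using assms(1,2) unfolding is_plane_def by blast
  have "V \<subseteq> W"
    using assms(3) vec.subspace_0[OF W(1)] unfolding V(3) W(3) by blast
  then have "V = W"
    using V W by (intro vec.subspace_dim_equal) auto
  then show ?thesis
    unfolding V(3) W(3) by simp
qed

text \<open>Two distinct spaces of dimension 3 meet in dimension at most 2, which the space of the
  line already fills.\<close>

lemma is_line_eq_Int:
  assumes "is_line L" "is_plane A" "is_plane B" "A \<noteq> B" "L \<subseteq> A" "L \<subseteq> B"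
  shows "L = A \<inter> B"
proof -
  obtain U V W where U: "vec.subspace U" "vec.dim U = 2" "L = U - {0}"
    and V: "vec.subspace V" "vec.dim V = 3" "A = V - {0}"
    and W: "vec.subspace W" "vec.dim W = 3" "B = W - {0}"
    using assms(1-3) unfolding is_plane_def is_line_def by blast
  have K: "vec.subspace (V \<inter> W)"
    using V(1) W(1) by (rule vec.subspace_inter)
  have "U \<subseteq> V \<inter> W"
    using assms(5,6) vec.subspace_0[OF V(1)] vec.subspace_0[OF W(1)] unfolding U(3) V(3) W(3) by blast
  moreover have "vec.dim (V \<inter> W) \<le> 2"
  proof (rule ccontr)
    assume "\<not> ?thesis"
    then have "vec.dim (V \<inter> W) \<ge> 3" by simp
    then have "V \<inter> W = V" "V \<inter> W = W"
      using vec.subspace_dim_equal[OF K V(1)] vec.subspace_dim_equal[OF K W(1)] V(2) W(2) by auto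
    then show False
      using assms(4) V(3) W(3) by simp
  qed
  ultimately have "U = V \<inter> W"
    using U K by (intro vec.subspace_dim_equal) auto
  then show ?thesis
    unfolding U(3) V(3) W(3) by blast
qed

text \<open>If \<open>p\<close> and \<open>q\<close> were multiples of one vector \<open>v\<close>,
  all of \<open>Z\<close> and therefore its closure would be the single projective point
  \<open>v\<close>. Collinearity is phrased through a common \<open>v\<close> so that it includes
  the cases \<open>p = 0\<close> and \<open>q = 0\<close>.\<close>

lemma is_line_closure_not_collinear:
  assumes line: "is_line (zariski_closure Z)"
    and Z: "\<And>x. x \<in> Z \<Longrightarrow> x \<noteq> 0 \<and> (\<exists>a b. x = a *s p + b *s q)"
  shows "\<nexists>v c d. p = c *s v \<and> q = d *s v"
proof
  assume "\<exists>v c d. p = c *s v \<and> q = d *s v"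
  then obtain v0 c0 d0 where pq0: "p = c0 *s v0" "q = d0 *s v0" by blast
  \<comment> \<open>For \<open>v0 = 0\<close> both vectors are zero, and any nonzero vector can
    replace \<open>v0\<close>.\<close>
  obtain v c d where v: "v \<noteq> 0" and pq: "p = c *s v" "q = d *s v"
  proof (cases "v0 = 0")
    case True
    show ?thesis
    proof (rule that)
      show "axis 0 1 \<noteq> (0 :: complex ^ 4)" by (simp add: axis_eq_0_iff)
      show "p = 0 *s axis 0 1" "q = 0 *s axis 0 1"
        using pq0 True by simp_all
    qed
  qed (use pq0 that in blast)
  \<comment> \<open>The forms sending \<open>x\<close> to
    \<open>v $ m * x $ n - v $ n * x $ m\<close>, whose common zeros are the multiples of
    \<open>v\<close>.\<close>
  define L where "L = {v $ m *s axis n 1 - v $ n *s axis m 1 | m n. True}"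
  have axis_product: "axis n 1 \<odot> x = x $ n" for n and x :: "complex ^ 4"
    by (simp add: scalar_product_def axis_def if_distrib[of "\<lambda>z. z * _"] cong: if_cong)
  have L: "(\<forall>a\<in>L. a \<odot> x = 0) \<longleftrightarrow> (\<forall>m n. v $ m * x $ n = v $ n * x $ m)" for x
  proof -
    have "(\<forall>a\<in>L. a \<odot> x = 0) \<longleftrightarrow> (\<forall>m n. (v $ m *s axis n 1 - v $ n *s axis m 1) \<odot> x = 0)"
      unfolding L_def by blast
    then show ?thesis
      by (simp add: scalar_product_linear axis_product)
  qed
  have "Z \<subseteq> {x. x \<noteq> 0 \<and> (\<forall>a\<in>L. a \<odot> x = 0)}"
    unfolding L using Z pq by (fastforce simp: algebra_simps)
  then have closure: "zariski_closure Z \<subseteq> {x. x \<noteq> 0 \<and> (\<forall>a\<in>L. a \<odot> x = 0)}"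
    by (intro zariski_closure_least zariski_closed_linear)
  obtain V where V: "vec.subspace V" "vec.dim V = 2" "zariski_closure Z = V - {0}"
    using line unfolding is_line_def by blast
  obtain m where m: "v $ m \<noteq> 0"
    using v by (metis vec_eq_iff zero_index)
  have "V \<subseteq> vec.span {v}"
  proof
    fix x assume "x \<in> V"
    then have "x = 0 \<or> (\<forall>m n. v $ m * x $ n = v $ n * x $ m)"
      using closure unfolding V(3) L by blast
    then have "v $ m * x $ n = v $ n * x $ m" for n by auto
    then have "x = (x $ m / v $ m) *s v"
      using m by (simp add: vec_eq_iff field_simps)
    then show "x \<in> vec.span {v}"
      by (metis vec.span_base vec.span_scale singletonI)
  qed
  then have "vec.dim V \<le> card {v}"
    by (intro vec.dim_le_card) auto
  then show False
    using V(2) by simp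
qed

section \<open>Dependent linear forms and the nonvanishing of Delta\<close>

lemma of_real_vec_simps:
  "of_real_vec (x + y) = of_real_vec x + of_real_vec y"
  "of_real_vec (r *s x) = complex_of_real r *s of_real_vec x"
  "of_real_vec x \<odot> of_real_vec y = complex_of_real (x \<odot> y)"
  "of_real_vec x $ m = complex_of_real (x $ m)"
  by (simp_all add: of_real_vec_def vec_eq_iff scalar_product_def)

lemma of_real_vec_eq_iff: "of_real_vec x = of_real_vec y \<longleftrightarrow> x = y"
  by (simp add: of_real_vec_def vec_eq_iff)

lemma Delta_eq_wedge:
  "Delta a b c = wedge a b c $ 0"
  "complex_of_real (Delta a b c) = wedge (of_real_vec a) (of_real_vec b) (of_real_vec c) $ 0"
  by (simp_all add: Delta_def det_3 wedge_nth minor3_def of_real_vec_simps algebra_simps)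

lemma plane_of_eq: "plane_of v = {x. x \<noteq> 0 \<and> of_real_vec v \<odot> x = 0}"
  by (simp add: plane_of_def scalar_product_def of_real_vec_def)

text \<open>The vanishing determinant gives a row relation on the columns 1 to 3 only. The common
  zero \<open>p\<close> with \<open>p $ 0 = 1\<close> extends it to column 0.\<close>

lemma linear_dependence_of_Delta_eq_0:
  fixes a b c p :: "real ^ 4"
  assumes "Delta a b c = 0" "p $ 0 = 1" "a \<odot> p = 0" "b \<odot> p = 0" "c \<odot> p = 0"
  obtains x y z where "x \<noteq> 0 \<or> y \<noteq> 0 \<or> z \<noteq> 0" "x *s a + y *s b + z *s c = 0"
proof -
  define M :: "real ^ 3 ^ 3" where
    "M = vector [vector [a $ 1, a $ 2, a $ 3], vector [b $ 1, b $ 2, b $ 3], vector [c $ 1, c $ 2, c $ 3]]"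
  have "det (transpose M) = 0"
    using assms(1) by (simp add: Delta_def M_def)
  then have "\<not> invertible (transpose M)"
    by (simp add: invertible_det_nz)
  then obtain v where v: "v \<noteq> 0" "transpose M *v v = 0"
    unfolding invertible_left_inverse matrix_left_invertible_ker by blast
  have eqs: "v $ 1 * a $ n + v $ 2 * b $ n + v $ 3 * c $ n = 0" if "n \<in> {1, 2, 3}" for n
    using v(2) that
    by (auto simp: vec_eq_iff forall_3 matrix_vector_mult_def transpose_def M_def sum_3 mult.commute)
  \<comment> \<open>The left side is 0, and on the right all terms but the first vanish by
    \<open>eqs\<close>.\<close>
  have "v $ 1 * (a \<odot> p) + v $ 2 * (b \<odot> p) + v $ 3 * (c \<odot> p) =
      (v $ 1 * a $ 0 + v $ 2 * b $ 0 + v $ 3 * c $ 0) * p $ 0 +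
      (v $ 1 * a $ 1 + v $ 2 * b $ 1 + v $ 3 * c $ 1) * p $ 1 +
      (v $ 1 * a $ 2 + v $ 2 * b $ 2 + v $ 3 * c $ 2) * p $ 2 +
      (v $ 1 * a $ 3 + v $ 2 * b $ 3 + v $ 3 * c $ 3) * p $ 3"
    unfolding scalar_product_4 by (simp add: algebra_simps)
  then have "v $ 1 * a $ 0 + v $ 2 * b $ 0 + v $ 3 * c $ 0 = 0"
    using assms eqs by simp
  then have "v $ 1 *s a + v $ 2 *s b + v $ 3 *s c = 0"
    using eqs by (simp add: vec_eq_iff all_4_from_0)
  moreover have "v $ 1 \<noteq> 0 \<or> v $ 2 \<noteq> 0 \<or> v $ 3 \<noteq> 0"
    using v(1) by (simp add: vec_eq_iff forall_3)
  ultimately show ?thesis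
    using that by blast
qed

lemma plane_of_subset_of_dependence:
  assumes "x *s a + y *s b + z *s c = 0" "x \<noteq> 0"
  shows "plane_of b \<inter> plane_of c \<subseteq> plane_of a"
proof -
  have "complex_of_real x * (of_real_vec a \<odot> v) + complex_of_real y * (of_real_vec b \<odot> v) +
      complex_of_real z * (of_real_vec c \<odot> v) = 0" for v
    using arg_cong[OF assms(1), of "\<lambda>u. of_real_vec u \<odot> v"]
    by (simp add: of_real_vec_simps scalar_product_linear) (simp add: of_real_vec_def scalar_product_def)
  then show ?thesis
    using assms(2) unfolding plane_of_eq
    by auto (metis add.right_neutral mult_eq_0_iff mult_zero_right of_real_eq_0_iff)
qed

text \<open>A dependence among the three forms must involve both \<open>a\<close> and
  \<open>b\<close>, as otherwise two of the planes would be equal. Each of these two forms is then a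
  combination of the other and \<open>c\<close>, so the two planes cut the same line out of
  \<open>plane_of c\<close>.\<close>

lemma Delta_nonzero_of_distinct_lines:
  assumes "is_plane (plane_of a)" "is_plane (plane_of b)" "is_plane (plane_of c)"
    and "plane_of a \<noteq> plane_of c" "plane_of b \<noteq> plane_of c"
    and "plane_of a \<inter> plane_of c \<noteq> plane_of b \<inter> plane_of c"
    and "p $ 0 = 1" "a \<odot> p = 0" "b \<odot> p = 0" "c \<odot> p = 0"
  shows "Delta a b c \<noteq> 0"
proof
  assume "Delta a b c = 0"
  then obtain x y z where nz: "x \<noteq> 0 \<or> y \<noteq> 0 \<or> z \<noteq> 0" and dep: "x *s a + y *s b + z *s c = 0"
    using assms(7-10) by (rule linear_dependence_of_Delta_eq_0)
  have no_pair: "y = 0 \<and> z = 0"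
    if "y *s b' + z *s c = 0" "is_plane (plane_of b')" "plane_of b' \<noteq> plane_of c" for b' y z
  proof -
    have "plane_of c \<subseteq> plane_of b'" if "y \<noteq> 0"
      \<comment> \<open>A relation between two forms is padded by a third term with coefficient 0,
        so that the intersection is that of a plane with itself.\<close>
      using plane_of_subset_of_dependence[of y b' z c 0 c] that \<open>y *s b' + z *s c = 0\<close> by simp
    moreover have "plane_of b' \<subseteq> plane_of c" if "z \<noteq> 0"
      using plane_of_subset_of_dependence[of z c y b' 0 b'] that \<open>y *s b' + z *s c = 0\<close>
      by (simp add: add.commute)
    ultimately show ?thesis
      using that(2,3) assms(3) is_plane_subset_eq by metis
  qed
  have "x \<noteq> 0"
    using no_pair[of y b z] nz dep assms(2,5) by auto
  moreover have "y \<noteq> 0"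
    using no_pair[of x a z] nz dep assms(1,4) by auto
  moreover have "y *s b + x *s a + z *s c = 0"
    using dep by (simp add: add_ac)
  ultimately have "plane_of b \<inter> plane_of c \<subseteq> plane_of a" "plane_of a \<inter> plane_of c \<subseteq> plane_of b"
    using plane_of_subset_of_dependence dep by blast+
  then show False
    using assms(6) by blast
qed

section \<open>Trilinear maps\<close>

text \<open>The weights are absorbed into arbitrary complex vectors, which allows \<open>W\<close>
  to be written through control points or through wedges and the factors to be permuted.\<close>

definition trilinear ::
    "(2 \<Rightarrow> 2 \<Rightarrow> 2 \<Rightarrow> complex ^ 4) \<Rightarrow> complex ^ 2 \<Rightarrow> complex ^ 2 \<Rightarrow> complex ^ 2 \<Rightarrow> complex ^ 4" where
  "trilinear W s t u = (\<Sum>i\<in>UNIV. \<Sum>j\<in>UNIV. \<Sum>k\<in>UNIV. (s $ i * t $ j * u $ k) *s W i j k)"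

text \<open>This carries statements about the first parameter over to the other two.\<close>

lemma trilinear_cyclic: "trilinear (\<lambda>j k i. W i j k) t u s = trilinear W s t u"
  by (simp add: trilinear_def sum_2_from_0 algebra_simps)

lemma scalar_product_trilinear:
  "a \<odot> trilinear W s t u =
    (\<Sum>i\<in>UNIV. \<Sum>j\<in>UNIV. \<Sum>k\<in>UNIV. s $ i * t $ j * u $ k * (a \<odot> W i j k))"
  by (simp add: trilinear_def scalar_product_sum scalar_product_linear)

lemma trilinear_vertex: "trilinear W (axis i 1) (axis j 1) (axis k 1) = W i j k"
  using exhaust_2_from_0[of i] exhaust_2_from_0[of j] exhaust_2_from_0[of k]
  by (auto simp: trilinear_def sum_2_from_0 axis_def)

lemma trilinear_edge:
  "trilinear W s (y *s axis j 1) (z *s axis k 1) =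
    (s $ 0 * y * z) *s W 0 j k + (s $ 1 * y * z) *s W 1 j k"
  "trilinear W (x *s axis i 1) t (z *s axis k 1) =
    (x * t $ 0 * z) *s W i 0 k + (x * t $ 1 * z) *s W i 1 k"
  "trilinear W (x *s axis i 1) (y *s axis j 1) u =
    (x * y * u $ 0) *s W i j 0 + (x * y * u $ 1) *s W i j 1"
  using exhaust_2_from_0[of i] exhaust_2_from_0[of j] exhaust_2_from_0[of k]
  by (auto simp: trilinear_def sum_2_from_0 axis_def)

lemma scalar_product_trilinear_axis_eq_0:
  "(\<And>j k. a \<odot> W i j k = 0) \<Longrightarrow> a \<odot> trilinear W (x *s axis i 1) t u = 0"
  "(\<And>i k. a \<odot> W i j k = 0) \<Longrightarrow> a \<odot> trilinear W s (y *s axis j 1) u = 0"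
  "(\<And>i j. a \<odot> W i j k = 0) \<Longrightarrow> a \<odot> trilinear W s t (z *s axis k 1) = 0"
  using exhaust_2_from_0[of i] exhaust_2_from_0[of j] exhaust_2_from_0[of k]
  by (auto simp: scalar_product_trilinear sum_2_from_0 axis_def)

lemma trilinear_scale: "trilinear W (x *s s) (y *s t) (z *s u) = (x * y * z) *s trilinear W s t u"
  by (simp add: trilinear_def sum_2_from_0 vector_add_ldistrib vector_smult_assoc mult_ac)

lemma trihomogeneous_poly_coordinate:
  "trihomogeneous_poly 1 0 0 (\<lambda>s t u. s $ i)"
  "trihomogeneous_poly 0 1 0 (\<lambda>s t u. t $ i)"
  "trihomogeneous_poly 0 0 1 (\<lambda>s t u. u $ i)"
proof -
  note mono = trihomogeneous_poly_monomial[where r = 1]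
  show "trihomogeneous_poly 1 0 0 (\<lambda>s t u. s $ i)"
    using exhaust_2_from_0[of i] mono[of 0 1 0 0 0 0] mono[of 1 1 0 0 0 0] by auto
  show "trihomogeneous_poly 0 1 0 (\<lambda>s t u. t $ i)"
    using exhaust_2_from_0[of i] mono[of 0 0 0 1 0 0] mono[of 0 0 1 1 0 0] by auto
  show "trihomogeneous_poly 0 0 1 (\<lambda>s t u. u $ i)"
    using exhaust_2_from_0[of i] mono[of 0 0 0 0 0 1] mono[of 0 0 0 0 1 1] by auto
qed

lemma trihomogeneous_poly_const: "trihomogeneous_poly 0 0 0 (\<lambda>s t u. r)"
  using trihomogeneous_poly_monomial[of 0 0 0 0 0 0 r] by simp

lemma trihomogeneous_poly_scalar_product_trilinear:
  "trihomogeneous_poly 1 1 1 (\<lambda>s t u. a \<odot> trilinear W s t u)"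
proof -
  have "trihomogeneous_poly 1 1 1 (\<lambda>s t u. s $ i * t $ j * u $ k * (a \<odot> W i j k))" for i j k
    using trihomogeneous_poly_mult[OF trihomogeneous_poly_mult[OF trihomogeneous_poly_mult[OF
      trihomogeneous_poly_coordinate(1) trihomogeneous_poly_coordinate(2)]
      trihomogeneous_poly_coordinate(3)] trihomogeneous_poly_const, of i j k "a \<odot> W i j k"]
    by simp
  then show ?thesis
    unfolding scalar_product_trilinear by (intro trihomogeneous_poly_sum)
qed

lemma trihomogeneous_poly_diff:
  assumes "trihomogeneous_poly a b c F" "trihomogeneous_poly a b c G"
  shows "trihomogeneous_poly a b c (\<lambda>s t u. F s t u - G s t u)"
  using trihomogeneous_poly_add[OF assms(1) trihomogeneous_poly_mult[OF trihomogeneous_poly_const assms(2), of "-1", simplified]]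
  by simp

text \<open>Each of the three arguments is linear in \<open>x\<close>, so the composition is cubic.
  This makes the nonvanishing of the map after its candidate inverse a Zariski open
  condition.\<close>

lemma homogeneous_poly_trilinear:
  "homogeneous_poly 3
    (\<lambda>x. trilinear W (\<chi> i. a i \<odot> x) (\<chi> j. b j \<odot> x) (\<chi> k. c k \<odot> x) $ m)"
proof -
  have "homogeneous_poly 3 (\<lambda>x. (a i \<odot> x) * (b j \<odot> x) * (c k \<odot> x) * W i j k $ m)" for i j k
    using homogeneous_poly_mult[OF homogeneous_poly_mult[OF homogeneous_poly_mult[OF
      homogeneous_poly_linear homogeneous_poly_linear] homogeneous_poly_linear]
      homogeneous_poly_monomial[of "\<lambda>_. 0" 0], of "a i" "b j" "c k" "W i j k $ m"]
    by (simp add: numeral_3_eq_3)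
  then show ?thesis
    unfolding trilinear_def by (simp add: sum_component) (intro homogeneous_poly_sum)
qed

lemma vertexE:
  assumes "x \<in> vertex i"
  obtains c where "x = c *s axis i 1"
  using assms unfolding vertex_def proj_eq_def by blast

lemma vertex_axis: "axis i 1 \<in> vertex i" "axis i 1 \<in> proj_line"
  unfolding vertex_def proj_eq_def by (auto simp: axis_eq_0_iff intro!: exI[of _ 1])

lemma vertex_subset_proj_line: "vertex i \<subseteq> proj_line"
  unfolding vertex_def proj_eq_def by auto

section \<open>Planes, edges and vertices of a hexahedral map\<close>

locale hexahedral_map =
  fixes w :: "2 \<Rightarrow> 2 \<Rightarrow> 2 \<Rightarrow> real"
    and P :: "2 \<Rightarrow> 2 \<Rightarrow> 2 \<Rightarrow> real ^ 4"
    and \<sigma> \<tau> \<upsilon> :: "2 \<Rightarrow> real ^ 4"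
  assumes control_points: "P i j k $ 0 = 1"
    and nondeg: "nondegenerate w P"
    and hexa: "hexahedral w P"
    and sigma: "Sigma_surface w P i = plane_of (\<sigma> i)"
    and tau: "T_surface w P j = plane_of (\<tau> j)"
    and upsilon: "Y_surface w P k = plane_of (\<upsilon> k)"
begin

definition W :: "2 \<Rightarrow> 2 \<Rightarrow> 2 \<Rightarrow> complex ^ 4" where
  "W i j k = complex_of_real (w i j k) *s of_real_vec (P i j k)"

lemma trilinear_map_eq: "trilinear_map w P = trilinear W"
  by (intro ext) (simp add: trilinear_map_def trilinear_def W_def vector_smult_assoc mult_ac)

lemma image_onE:
  assumes "x \<in> image_on w P S T U"
  obtains s t u where "s \<in> S" "t \<in> T" "u \<in> U" "x = trilinear W s t u" "x \<noteq> 0"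
  using assms unfolding image_on_def trilinear_map_eq by blast

lemma image_on_mono:
  "S \<subseteq> S' \<Longrightarrow> T \<subseteq> T' \<Longrightarrow> U \<subseteq> U' \<Longrightarrow> image_on w P S T U \<subseteq> image_on w P S' T' U'"
  unfolding image_on_def by blast

lemma lines_subset_surfaces:
  "s_line w P j k \<subseteq> plane_of (\<tau> j)" "s_line w P j k \<subseteq> plane_of (\<upsilon> k)"
  "t_line w P i k \<subseteq> plane_of (\<sigma> i)" "t_line w P i k \<subseteq> plane_of (\<upsilon> k)"
  unfolding s_line_def t_line_def
    Sigma_surface_def[symmetric] T_surface_def[symmetric] Y_surface_def[symmetric]
    sigma[symmetric] tau[symmetric] upsilon[symmetric]
  unfolding Sigma_surface_def T_surface_def Y_surface_def
  by (intro zariski_closure_mono image_on_mono vertex_subset_proj_line order_refl)+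

text \<open>The image of an edge lies in the span of its two end vectors, while its closure is a
  line by nondegeneracy.\<close>

lemma edge_not_collinear:
  "\<nexists>v c d. W 0 j k = c *s v \<and> W 1 j k = d *s v"
  "\<nexists>v c d. W i 0 k = c *s v \<and> W i 1 k = d *s v"
  "\<nexists>v c d. W i j 0 = c *s v \<and> W i j 1 = d *s v"
proof -
  have lines: "is_line (s_line w P j k)" "is_line (t_line w P i k)" "is_line (u_line w P i j)"
    using nondeg unfolding nondegenerate_def by blast+
  note lines = lines[unfolded s_line_def t_line_def u_line_def]
  show "\<nexists>v c d. W 0 j k = c *s v \<and> W 1 j k = d *s v"
  proof (rule is_line_closure_not_collinear[OF lines(1)])
    fix x assume "x \<in> image_on w P proj_line (vertex j) (vertex k)"
    then obtain s t u where "s \<in> proj_line" "t \<in> (vertex j)" "u \<in> (vertex k)" "x = trilinear W s t u" "x \<noteq> 0"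
      by (rule image_onE)
    then show "x \<noteq> 0 \<and> (\<exists>a b. x = a *s W 0 j k + b *s W 1 j k)"
      by (elim vertexE) (use trilinear_edge(1) in blast)
  qed
  show "\<nexists>v c d. W i 0 k = c *s v \<and> W i 1 k = d *s v"
  proof (rule is_line_closure_not_collinear[OF lines(2)])
    fix x assume "x \<in> image_on w P (vertex i) proj_line (vertex k)"
    then obtain s t u where "s \<in> (vertex i)" "t \<in> proj_line" "u \<in> (vertex k)" "x = trilinear W s t u" "x \<noteq> 0"
      by (rule image_onE)
    then show "x \<noteq> 0 \<and> (\<exists>a b. x = a *s W i 0 k + b *s W i 1 k)"
      by (elim vertexE) (use trilinear_edge(2) in blast)
  qed
  show "\<nexists>v c d. W i j 0 = c *s v \<and> W i j 1 = d *s v"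
  proof (rule is_line_closure_not_collinear[OF lines(3)])
    fix x assume "x \<in> image_on w P (vertex i) (vertex j) proj_line"
    then obtain s t u where "s \<in> (vertex i)" "t \<in> (vertex j)" "u \<in> proj_line" "x = trilinear W s t u" "x \<noteq> 0"
      by (rule image_onE)
    then show "x \<noteq> 0 \<and> (\<exists>a b. x = a *s W i j 0 + b *s W i j 1)"
      by (elim vertexE) (use trilinear_edge(3) in blast)
  qed
qed

text \<open>A zero weight makes one end vector of an edge zero, hence a multiple of the other end
  vector.\<close>

lemma weight_nonzero: "w i j k \<noteq> 0"
proof
  assume "w i j k = 0"
  then have "W i j k = 0 *s v" for v
    by (simp add: W_def)
  moreover have "v = 1 *s v" for v :: "complex ^ 4" by simp
  ultimately have "\<exists>v c d. W 0 j k = c *s v \<and> W 1 j k = d *s v"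
    using exhaust_2_from_0[of i] by blast
  then show False
    using edge_not_collinear(1) by blast
qed

lemma control_points_distinct:
  "i \<noteq> i' \<Longrightarrow> P i j k \<noteq> P i' j k" "j \<noteq> j' \<Longrightarrow> P i j k \<noteq> P i j' k" "k \<noteq> k' \<Longrightarrow> P i j k \<noteq> P i j k'"
proof -
  have cases: "(i = 0 \<and> i' = 1) \<or> (i = 1 \<and> i' = 0)" if "i \<noteq> i'" for i i' :: 2
    using exhaust_2_from_0[of i] exhaust_2_from_0[of i'] that by blast
  have neq: "p \<noteq> q" if "\<nexists>v c d. x *s of_real_vec p = c *s v \<and> y *s of_real_vec q = d *s v" for p q x y
    using that by blast
  have "P 0 j k \<noteq> P 1 j k" "P i 0 k \<noteq> P i 1 k" "P i j 0 \<noteq> P i j 1" for i j k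
    by (rule neq, rule edge_not_collinear[unfolded W_def])+
  note * = this this[symmetric]
  show "P i j k \<noteq> P i' j k" if "i \<noteq> i'"
    using cases[OF that] * by (elim disjE conjE) simp_all
  show "P i j k \<noteq> P i j' k" if "j \<noteq> j'"
    using cases[OF that] * by (elim disjE conjE) simp_all
  show "P i j k \<noteq> P i j k'" if "k \<noteq> k'"
    using cases[OF that] * by (elim disjE conjE) simp_all
qed

lemma W_nonzero: "W i j k \<noteq> 0"
proof -
  have "W i j k $ 0 \<noteq> 0"
    using weight_nonzero by (simp add: W_def of_real_vec_simps control_points)
  then show ?thesis by auto
qed

lemma W_in_image_on:
  "axis i 1 \<in> S \<Longrightarrow> axis j 1 \<in> T \<Longrightarrow> axis k 1 \<in> U \<Longrightarrow> W i j k \<in> image_on w P S T U"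
  using W_nonzero[of i j k] trilinear_vertex[of W i j k]
  unfolding image_on_def trilinear_map_eq mem_Collect_eq by metis

text \<open>The map sends each vertex of the parameter cube to a nonzero multiple of its control
  point, and this vertex lies on three faces.\<close>

lemma incidence: "\<sigma> i \<odot> P i j k = 0" "\<tau> j \<odot> P i j k = 0" "\<upsilon> k \<odot> P i j k = 0"
proof -
  have "W i j k \<in> plane_of (\<sigma> i)" "W i j k \<in> plane_of (\<tau> j)" "W i j k \<in> plane_of (\<upsilon> k)"
    unfolding sigma[symmetric] tau[symmetric] upsilon[symmetric]
      Sigma_surface_def T_surface_def Y_surface_def
    by (intro subsetD[OF zariski_closure_superset] W_in_image_on vertex_axis)+
  then show "\<sigma> i \<odot> P i j k = 0" "\<tau> j \<odot> P i j k = 0" "\<upsilon> k \<odot> P i j k = 0"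
    using weight_nonzero by (simp_all add: plane_of_eq W_def scalar_product_linear of_real_vec_simps)
qed

text \<open>The lines in which \<open>plane_of (\<upsilon> k)\<close> meets the planes of
  \<open>\<tau> j\<close> and \<open>\<sigma> i\<close> are the boundary lines
  \<open>s_line w P j k\<close> and \<open>t_line w P i k\<close>, which nondegeneracy keeps
  distinct.\<close>

lemma Delta_nonzero: "Delta (\<sigma> i) (\<tau> j) (\<upsilon> k) \<noteq> 0"
proof -
  have planes: "is_plane (plane_of (\<sigma> i))" "is_plane (plane_of (\<tau> j))" "is_plane (plane_of (\<upsilon> k))"
    using hexa unfolding hexahedral_def sigma tau upsilon by blast+
  have lines: "is_line (s_line w P j k)" "is_line (t_line w P i k)"
    using nondeg unfolding nondegenerate_def by blast+
  have "distinct [plane_of (\<sigma> 0), plane_of (\<sigma> 1), plane_of (\<tau> 0), plane_of (\<tau> 1),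
      plane_of (\<upsilon> 0), plane_of (\<upsilon> 1)]"
    using nondeg unfolding nondegenerate_def sigma tau upsilon by blast
  then have neq: "plane_of (\<sigma> i) \<noteq> plane_of (\<upsilon> k)" "plane_of (\<tau> j) \<noteq> plane_of (\<upsilon> k)"
    using exhaust_2_from_0[of i] exhaust_2_from_0[of j] exhaust_2_from_0[of k]
    by (elim disjE; simp)+
  have "distinct [s_line w P 0 0, s_line w P 0 1, s_line w P 1 0, s_line w P 1 1,
              t_line w P 0 0, t_line w P 0 1, t_line w P 1 0, t_line w P 1 1]"
    using nondeg unfolding nondegenerate_def by simp
  then have "s_line w P j k \<noteq> t_line w P i k"
    using exhaust_2_from_0[of i] exhaust_2_from_0[of j] exhaust_2_from_0[of k]
    by (elim disjE; simp)
  moreover have "s_line w P j k = plane_of (\<tau> j) \<inter> plane_of (\<upsilon> k)"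
    by (rule is_line_eq_Int[OF lines(1) planes(2,3) neq(2) lines_subset_surfaces(1,2)])
  moreover have "t_line w P i k = plane_of (\<sigma> i) \<inter> plane_of (\<upsilon> k)"
    by (rule is_line_eq_Int[OF lines(2) planes(1,3) neq(1) lines_subset_surfaces(3,4)])
  ultimately have "plane_of (\<sigma> i) \<inter> plane_of (\<upsilon> k) \<noteq> plane_of (\<tau> j) \<inter> plane_of (\<upsilon> k)"
    by (simp only: not_sym)
  then show ?thesis
    by (rule Delta_nonzero_of_distinct_lines[OF planes neq _ control_points incidence])
qed

definition v :: "2 \<Rightarrow> 2 \<Rightarrow> 2 \<Rightarrow> real" where
  "v i j k = w i j k / Delta (\<sigma> i) (\<tau> j) (\<upsilon> k)"

lemma v_nonzero: "v i j k \<noteq> 0"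
  using weight_nonzero Delta_nonzero by (simp add: v_def)

abbreviation "S i \<equiv> of_real_vec (\<sigma> i)"
abbreviation "T j \<equiv> of_real_vec (\<tau> j)"
abbreviation "Y k \<equiv> of_real_vec (\<upsilon> k)"

text \<open>This is \<open>wedge_collinear\<close> read at coordinate 0, where \<open>p\<close> has
  entry 1 and the wedge has entry Delta.\<close>

lemma wedge_eq_Delta_scale:
  "p $ 0 = 1 \<Longrightarrow> \<sigma> i \<odot> p = 0 \<Longrightarrow> \<tau> j \<odot> p = 0 \<Longrightarrow> \<upsilon> k \<odot> p = 0 \<Longrightarrow>
    wedge (S i) (T j) (Y k) = complex_of_real (Delta (\<sigma> i) (\<tau> j) (\<upsilon> k)) *s of_real_vec p"
  using wedge_collinear[of "S i" "of_real_vec p" "T j" "Y k" 0]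
  by (simp add: of_real_vec_simps Delta_eq_wedge(2))

lemma W_eq_wedge: "W i j k = complex_of_real (v i j k) *s wedge (S i) (T j) (Y k)"
  using wedge_eq_Delta_scale[OF control_points incidence, of i j k] Delta_nonzero[of i j k]
  by (simp add: W_def v_def vector_smult_assoc)

lemma common_point_unique:
  assumes "p $ 0 = 1" "\<sigma> i \<odot> p = 0" "\<tau> j \<odot> p = 0" "\<upsilon> k \<odot> p = 0"
  shows "p = P i j k"
proof -
  have "complex_of_real (Delta (\<sigma> i) (\<tau> j) (\<upsilon> k)) *s of_real_vec p =
      complex_of_real (Delta (\<sigma> i) (\<tau> j) (\<upsilon> k)) *s of_real_vec (P i j k)"
    by (rule trans[OF wedge_eq_Delta_scale[OF assms, symmetric] wedge_eq_Delta_scale[OF control_points incidence]])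
  then have "of_real_vec p = of_real_vec (P i j k)"
    using Delta_nonzero by (simp add: vector_mul_lcancel)
  then show ?thesis
    by (simp add: of_real_vec_eq_iff)
qed

text \<open>If \<open>\<sigma> i'\<close> vanished at \<open>P i j k\<close>, this point would be
  the common point \<open>P i' j k\<close> of the planes of \<open>\<sigma> i'\<close>,
  \<open>\<tau> j\<close> and \<open>\<upsilon> k\<close>, but the ends of an edge are
  distinct.\<close>

lemma opposite_nonzero:
  "i \<noteq> i' \<Longrightarrow> S i' \<odot> wedge (S i) (T j) (Y k) \<noteq> 0"
  "j \<noteq> j' \<Longrightarrow> T j' \<odot> wedge (S i) (T j) (Y k) \<noteq> 0"
  "k \<noteq> k' \<Longrightarrow> Y k' \<odot> wedge (S i) (T j) (Y k) \<noteq> 0"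
proof -
  have "i \<noteq> i' \<Longrightarrow> \<sigma> i' \<odot> P i j k \<noteq> 0"
    using common_point_unique[of "P i j k" i' j k] control_points_distinct(1) control_points incidence
    by blast
  moreover have "j \<noteq> j' \<Longrightarrow> \<tau> j' \<odot> P i j k \<noteq> 0"
    using common_point_unique[of "P i j k" i j' k] control_points_distinct(2) control_points incidence
    by blast
  moreover have "k \<noteq> k' \<Longrightarrow> \<upsilon> k' \<odot> P i j k \<noteq> 0"
    using common_point_unique[of "P i j k" i j k'] control_points_distinct(3) control_points incidence
    by blast
  ultimately show
    "i \<noteq> i' \<Longrightarrow> S i' \<odot> wedge (S i) (T j) (Y k) \<noteq> 0"
    "j \<noteq> j' \<Longrightarrow> T j' \<odot> wedge (S i) (T j) (Y k) \<noteq> 0"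
    "k \<noteq> k' \<Longrightarrow> Y k' \<odot> wedge (S i) (T j) (Y k) \<noteq> 0"
    unfolding wedge_eq_Delta_scale[OF control_points incidence] scalar_product_linear of_real_vec_simps
    using Delta_nonzero[of i j k] by simp_all
qed

text \<open>A form vanishing at the four corner vectors of a face vanishes on the image of that face
  by trilinearity. Its zero set is closed, so it contains the closure, which is the whole
  plane.\<close>

lemma surface_spanned:
  "(\<And>j k. a \<odot> W i j k = 0) \<Longrightarrow> S i \<odot> x = 0 \<Longrightarrow> a \<odot> x = 0"
  "(\<And>i k. a \<odot> W i j k = 0) \<Longrightarrow> T j \<odot> x = 0 \<Longrightarrow> a \<odot> x = 0"
  "(\<And>i j. a \<odot> W i j k = 0) \<Longrightarrow> Y k \<odot> x = 0 \<Longrightarrow> a \<odot> x = 0"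
proof -
  have closure: "a \<odot> x = 0"
    if "zariski_closure Z = plane_of p" "of_real_vec p \<odot> x = 0"
      "\<And>y. y \<in> Z \<Longrightarrow> y \<noteq> 0 \<and> a \<odot> y = 0" for Z p
  proof -
    have "Z \<subseteq> {x. x \<noteq> 0 \<and> (\<forall>a\<in>{a}. a \<odot> x = 0)}"
      using that(3) by auto
    then have "plane_of p \<subseteq> {x. x \<noteq> 0 \<and> (\<forall>a\<in>{a}. a \<odot> x = 0)}"
      unfolding that(1)[symmetric] by (intro zariski_closure_least zariski_closed_linear)
    then show ?thesis
      using that(2) by (cases "x = 0") (auto simp: plane_of_eq scalar_product_linear)
  qed
  show "a \<odot> x = 0" if "\<And>j k. a \<odot> W i j k = 0" "S i \<odot> x = 0"
    by (rule closure[OF sigma[unfolded Sigma_surface_def] that(2)])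
       (auto elim!: image_onE vertexE intro!: scalar_product_trilinear_axis_eq_0 that(1))
  show "a \<odot> x = 0" if "\<And>i k. a \<odot> W i j k = 0" "T j \<odot> x = 0"
    by (rule closure[OF tau[unfolded T_surface_def] that(2)])
       (auto elim!: image_onE vertexE intro!: scalar_product_trilinear_axis_eq_0 that(1))
  show "a \<odot> x = 0" if "\<And>i j. a \<odot> W i j k = 0" "Y k \<odot> x = 0"
    by (rule closure[OF upsilon[unfolded Y_surface_def] that(2)])
       (auto elim!: image_onE vertexE intro!: scalar_product_trilinear_axis_eq_0 that(1))
qed

end

section \<open>From an inverse of type (1, 1, 1) to the weights\<close>

text \<open>
  The identity says that the linear forms \<open>a\<close> invert the map in the first parameter. At \<open>s = (1:0)\<close>
  it shows that \<open>a 1\<close> vanishes on the plane \<open>\<sigma> 0\<close>, hence is a multiple of \<open>\<sigma> 0\<close>, and likewise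
  \<open>a 0\<close> is a multiple of \<open>\<sigma> 1\<close>; the mixed coefficient then compares \<open>v 0 j k\<close> with \<open>v 1 j k\<close>.
\<close>

lemma weights_proportional:
  fixes v :: "2 \<Rightarrow> 2 \<Rightarrow> 2 \<Rightarrow> complex" and \<sigma> \<tau> \<upsilon> a :: "2 \<Rightarrow> complex ^ 4"
  assumes W: "\<And>i j k. W i j k = v i j k *s wedge (\<sigma> i) (\<tau> j) (\<upsilon> k)"
    and v: "\<And>i j k. v i j k \<noteq> 0"
    and opposite: "\<And>j k. \<sigma> 1 \<odot> wedge (\<sigma> 0) (\<tau> j) (\<upsilon> k) \<noteq> 0"
    and spanned: "\<And>i p x. (\<And>j k. p \<odot> W i j k = 0) \<Longrightarrow> \<sigma> i \<odot> x = 0 \<Longrightarrow> p \<odot> x = 0"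
    and inverse: "\<And>s t u. s $ 1 * (a 0 \<odot> trilinear W s t u) = s $ 0 * (a 1 \<odot> trilinear W s t u)"
    and nonzero: "a 0 \<odot> x \<noteq> 0 \<or> a 1 \<odot> x \<noteq> 0"
  shows "\<exists>r. \<forall>j k. v 1 j k = r * v 0 j k"
proof -
  have a1: "a 1 \<odot> W 0 j k = 0" for j k
    using inverse[of "axis 0 1" "axis j 1" "axis k 1"] unfolding trilinear_vertex by (simp add: axis_def)
  have a0: "a 0 \<odot> W 1 j k = 0" for j k
    using inverse[of "axis 1 1" "axis j 1" "axis k 1"] unfolding trilinear_vertex by (simp add: axis_def)
  \<comment> \<open>At \<open>s = (1:1)\<close> the pure terms drop out by \<open>a0\<close> and
    \<open>a1\<close>, and only the mixed coefficient of the identity remains.\<close>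
  have "trilinear W (\<chi> i. 1) (axis j 1) (axis k 1) = W 0 j k + W 1 j k" for j k
    using trilinear_edge(1)[of W "\<chi> i. 1" 1 j 1 k] by simp
  then have mixed: "a 0 \<odot> W 0 j k = a 1 \<odot> W 1 j k" for j k
    using inverse[of "\<chi> i. 1" "axis j 1" "axis k 1"] a0 a1 by (simp add: scalar_product_linear)
  have multiple: "\<exists>c. \<forall>x. p \<odot> x = c * (\<sigma> i \<odot> x)"
    if "\<And>j k. p \<odot> W i j k = 0" "\<sigma> i \<odot> y \<noteq> 0" for p i y
  proof -
    have "p \<odot> x = p \<odot> y / (\<sigma> i \<odot> y) * (\<sigma> i \<odot> x)" for x
    proof -
      \<comment> \<open>This combination of \<open>x\<close> and \<open>y\<close> lies on the plane
        of \<open>\<sigma> i\<close>, where \<open>p\<close> vanishes.\<close>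
      have "p \<odot> ((\<sigma> i \<odot> y) *s x - (\<sigma> i \<odot> x) *s y) = 0"
        by (rule spanned[OF that(1)]) (simp add: scalar_product_linear)
      then show ?thesis
        using that(2) by (simp add: scalar_product_linear field_simps)
    qed
    then show ?thesis by blast
  qed
  have opposite': "\<sigma> 0 \<odot> wedge (\<sigma> 1) (\<tau> j) (\<upsilon> k) = - (\<sigma> 1 \<odot> wedge (\<sigma> 0) (\<tau> j) (\<upsilon> k))" for j k
    by (rule scalar_product_wedge_swap)
  obtain c0 where c0: "\<And>x. a 0 \<odot> x = c0 * (\<sigma> 1 \<odot> x)"
    using multiple[of "a 0" 1, OF a0 opposite] by blast
  obtain c1 where c1: "\<And>x. a 1 \<odot> x = c1 * (\<sigma> 0 \<odot> x)"
    using multiple[of "a 1" 0 "wedge (\<sigma> 1) (\<tau> 0) (\<upsilon> 0)", OF a1] opposite'[of 0 0] opposite[of 0 0]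
    by auto
  have coeff: "v 0 j k * c0 = - (v 1 j k * c1)" for j k
  proof -
    have "(v 0 j k * c0 + v 1 j k * c1) * (\<sigma> 1 \<odot> wedge (\<sigma> 0) (\<tau> j) (\<upsilon> k)) = 0"
      using mixed[of j k] unfolding W c0 c1 scalar_product_linear opposite'
      by (simp add: algebra_simps)
    then show ?thesis
      using opposite[of j k] by (simp add: eq_neg_iff_add_eq_0)
  qed
  \<comment> \<open>For \<open>c1 = 0\<close>, \<open>coeff\<close> would give \<open>c0 = 0\<close>
    as well, and both forms would vanish identically.\<close>
  have "c1 \<noteq> 0"
    using nonzero coeff[of 0 0] v[of 0 0 0] unfolding c0 c1 by auto
  then have "v 1 j k = (- c0 / c1) * v 0 j k" for j k
    using coeff[of j k] by (simp add: field_simps)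
  then show ?thesis by blast
qed

text \<open>Proportionality on \<open>U\<close> is turned into a vanishing cross product, which is
  trihomogeneous and so vanishes everywhere by density. The function \<open>g\<close> stands for any
  one of the three projections.\<close>

lemma inverse_identity:
  fixes g :: "complex ^ 2 \<Rightarrow> complex ^ 2 \<Rightarrow> complex ^ 2 \<Rightarrow> complex ^ 2"
  assumes U: "zariski_open3 U" "U \<noteq> {}"
    and g: "\<And>i. trihomogeneous_poly a b c (\<lambda>s t u. g s t u $ i)"
    and p: "\<And>x i. A x $ i = p i \<odot> x"
    and inverse: "\<And>s t u. (s, t, u) \<in> U \<Longrightarrow> proj_eq (g s t u) (A (trilinear W s t u))"
  shows "g s t u $ 1 * (p 0 \<odot> trilinear W s t u) = g s t u $ 0 * (p 1 \<odot> trilinear W s t u)"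
    and "\<exists>x. p 0 \<odot> x \<noteq> 0 \<or> p 1 \<odot> x \<noteq> 0"
proof -
  have "g s t u $ 1 * (p 0 \<odot> trilinear W s t u) - g s t u $ 0 * (p 1 \<odot> trilinear W s t u) = 0"
  proof (rule zariski_open3_dense[OF U trihomogeneous_poly_diff])
    have *: "trihomogeneous_poly (a + 1) (b + 1) (c + 1)
        (\<lambda>s t u. g s t u $ i * (p j \<odot> trilinear W s t u))" for i j
      by (rule trihomogeneous_poly_mult[OF g trihomogeneous_poly_scalar_product_trilinear])
    show "trihomogeneous_poly (a + 1) (b + 1) (c + 1) (\<lambda>s t u. g s t u $ 1 * (p 0 \<odot> trilinear W s t u))"
      "trihomogeneous_poly (a + 1) (b + 1) (c + 1) (\<lambda>s t u. g s t u $ 0 * (p 1 \<odot> trilinear W s t u))"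
      by (rule *)+
    fix s t u assume "(s, t, u) \<in> U"
    then obtain r where r: "A (trilinear W s t u) = r *s g s t u"
      using inverse unfolding proj_eq_def by blast
    show "g s t u $ 1 * (p 0 \<odot> trilinear W s t u) - g s t u $ 0 * (p 1 \<odot> trilinear W s t u) = 0"
      unfolding p[symmetric] r by simp
  qed
  then show "g s t u $ 1 * (p 0 \<odot> trilinear W s t u) = g s t u $ 0 * (p 1 \<odot> trilinear W s t u)"
    by simp
  obtain s t u where "(s, t, u) \<in> U"
    using U(2) by auto
  then have "A (trilinear W s t u) \<noteq> 0"
    using inverse unfolding proj_eq_def by blast
  then show "\<exists>x. p 0 \<odot> x \<noteq> 0 \<or> p 1 \<odot> x \<noteq> 0"
    unfolding vec_eq_iff all_2_from_0 p by auto
qed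

lemma coprime_pair_1_linear:
  assumes "coprime_pair 1 A"
  obtains p where "\<And>x i. A x $ i = p i \<odot> x"
proof -
  have "\<forall>i. \<exists>p. (\<lambda>x. A x $ i) = (\<lambda>x. p \<odot> x)"
    using assms unfolding coprime_pair_def homogeneous_poly_1_iff by blast
  then obtain p where "\<forall>i. (\<lambda>x. A x $ i) = (\<lambda>x. p i \<odot> x)"
    by (rule choice[THEN exE])
  then have "A x $ i = p i \<odot> x" for x i
    by (rule allE) (rule fun_cong)
  then show ?thesis
    by (rule that)
qed

lemma product_of_proportional:
  fixes v :: "2 \<Rightarrow> 2 \<Rightarrow> 2 \<Rightarrow> real"
  assumes "\<And>j k. v 1 j k = x * v 0 j k" "\<And>i k. v i 1 k = y * v i 0 k" "\<And>i j. v i j 1 = z * v i j 0"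
    and "v 0 0 0 \<noteq> 0"
  shows "\<exists>\<alpha> \<beta> \<gamma> :: real ^ 2. \<alpha> \<noteq> 0 \<and> \<beta> \<noteq> 0 \<and> \<gamma> \<noteq> 0 \<and> (\<forall>i j k. v i j k = \<alpha> $ i * \<beta> $ j * \<gamma> $ k)"
proof (intro exI conjI)
  \<comment> \<open>Each pair has the required ratio of entries; the overall constant
    \<open>v 0 0 0\<close> is put into the first pair.\<close>
  let ?pair = "\<lambda>c x :: real. \<chi> i :: 2. if i = 0 then c else c * x"
  show "?pair (v 0 0 0) x \<noteq> 0" "?pair 1 y \<noteq> 0" "?pair 1 z \<noteq> 0"
    using assms(4) by (simp_all add: vec_eq_iff all_2_from_0)
  show "\<forall>i j k. v i j k = ?pair (v 0 0 0) x $ i * ?pair 1 y $ j * ?pair 1 z $ k"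
    unfolding all_2_from_0 by (simp add: assms(1-3))
qed

section \<open>From the weights to the inverse\<close>

definition pencil :: "(2 \<Rightarrow> complex) \<Rightarrow> (2 \<Rightarrow> complex ^ 4) \<Rightarrow> complex ^ 2 \<Rightarrow> complex ^ 4" where
  "pencil \<alpha> \<sigma> s = (s $ 0 * \<alpha> 0) *s \<sigma> 0 + (s $ 1 * \<alpha> 1) *s \<sigma> 1"

text \<open>The parameter of the plane of the pencil through the point \<open>x\<close>.\<close>

definition parameter_form :: "(2 \<Rightarrow> complex) \<Rightarrow> (2 \<Rightarrow> complex ^ 4) \<Rightarrow> 2 \<Rightarrow> complex ^ 4" where
  "parameter_form \<alpha> \<sigma> i = (if i = 0 then \<alpha> 1 *s \<sigma> 1 else (- \<alpha> 0) *s \<sigma> 0)"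

definition parameter :: "(2 \<Rightarrow> complex) \<Rightarrow> (2 \<Rightarrow> complex ^ 4) \<Rightarrow> complex ^ 4 \<Rightarrow> complex ^ 2" where
  "parameter \<alpha> \<sigma> x = (\<chi> i. parameter_form \<alpha> \<sigma> i \<odot> x)"

text \<open>Multilinear expansion of the wedge of three pencil members yields one term for each
  vertex of the cube.\<close>

lemma trilinear_eq_wedge_pencil:
  "trilinear (\<lambda>i j k. (\<alpha> i * \<beta> j * \<gamma> k) *s wedge (\<sigma> i) (\<tau> j) (\<upsilon> k)) s t u =
    wedge (pencil \<alpha> \<sigma> s) (pencil \<beta> \<tau> t) (pencil \<gamma> \<upsilon> u)"
  unfolding trilinear_def pencil_def sum_2_from_0 wedge_linear
  by (simp add: vector_add_ldistrib vector_smult_assoc mult_ac add_ac)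

lemma pencil_parameter: "pencil \<alpha> \<sigma> (parameter \<alpha> \<sigma> x) \<odot> x = 0"
  by (simp add: pencil_def parameter_def parameter_form_def scalar_product_linear scalar_product_minus)

text \<open>Pairing with \<open>\<sigma> 1\<close> keeps only the \<open>\<sigma> 0\<close> term of
  the pencil and conversely. The sign in \<open>parameter_form\<close> cancels the sign of the swap,
  so both coordinates get the same factor.\<close>

lemma parameter_wedge_pencil:
  "parameter \<alpha> \<sigma> (wedge (pencil \<alpha> \<sigma> s) b c) = (\<alpha> 0 * \<alpha> 1 * (\<sigma> 1 \<odot> wedge (\<sigma> 0) b c)) *s s"
  using scalar_product_wedge_swap[of "\<sigma> 0" "\<sigma> 1" b c]
  by (simp add: vec_eq_iff all_2_from_0 parameter_def parameter_form_def pencil_def wedge_linear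
      scalar_product_linear scalar_product_minus wedge_orthogonal)

text \<open>A common factor \<open>H\<close> of positive degree leaves a constant cofactor
  \<open>Q\<close> in the second form. At \<open>p\<close> the second form vanishes and
  \<open>Q\<close> does not, so \<open>H\<close> vanishes there, although the first form, a multiple
  of \<open>H\<close>, is nonzero at \<open>p\<close>.\<close>

lemma coprime_pair_parameter:
  assumes "\<alpha> 0 \<noteq> 0" "\<alpha> 1 \<noteq> 0"
    and p: "\<sigma> 0 \<odot> p = 0" "\<sigma> 1 \<odot> p \<noteq> 0" and q: "\<sigma> 1 \<odot> q = 0" "\<sigma> 0 \<odot> q \<noteq> 0"
  shows "coprime_pair 1 (parameter \<alpha> \<sigma>)"
  unfolding coprime_pair_def
proof (intro conjI allI notI)
  show "homogeneous_poly 1 (\<lambda>x. parameter \<alpha> \<sigma> x $ i)" for i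
    unfolding parameter_def vec_lambda_beta by (rule homogeneous_poly_linear)
next
  let ?A = "parameter \<alpha> \<sigma>"
  have A: "?A p $ 0 \<noteq> 0" "?A p $ 1 = 0" "?A q $ 1 \<noteq> 0"
    using assms by (simp_all add: parameter_def parameter_form_def scalar_product_linear scalar_product_minus)
  assume "\<exists>e H. 1 \<le> e \<and> homogeneous_poly e H \<and> (\<forall>i. homogeneous_dvd H (\<lambda>x. ?A x $ i))"
  then obtain e H where e: "e \<ge> 1" and H: "homogeneous_poly e H"
    and dvd: "\<And>i. homogeneous_dvd H (\<lambda>x. ?A x $ i)" by blast
  obtain d Q where Q: "homogeneous_poly d Q" "\<And>x. ?A x $ 1 = H x * Q x"
    using dvd[of 1] unfolding homogeneous_dvd_def by blast
  \<comment> \<open>Polynomials are only functions here, so degrees are compared by scaling a point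
    where the form is nonzero by 2: \<open>2 ^ (e + d) = 2\<close>.\<close>
  have "?A (2 *s q) $ 1 = 2 * ?A q $ 1"
    by (simp add: parameter_def scalar_product_linear scalar_product_minus)
  then have "2 ^ e * 2 ^ d * ?A q $ 1 = 2 * ?A q $ 1"
    unfolding Q(2) homogeneous_poly_scaling[OF H] homogeneous_poly_scaling[OF Q(1)]
    by (simp add: mult_ac)
  then have "(2 :: complex) ^ (e + d) = of_nat (2 ^ 1)"
    using A(3) by (simp add: power_add)
  then have "of_nat (2 ^ (e + d)) = (of_nat (2 ^ 1) :: complex)"
    by simp
  then have "(2 :: nat) ^ (e + d) = 2 ^ 1"
    unfolding of_nat_eq_iff .
  then have "e + d = 1"
    by (subst (asm) power_inject_exp) auto
  then have "d = 0"
    using e by simp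
  \<comment> \<open>Scaling by 0 in degree 0, with \<open>0 ^ 0 = 1\<close>.\<close>
  have Q_const: "Q x = Q 0" for x
    using homogeneous_poly_scaling[OF Q(1), of 0 x] \<open>d = 0\<close> by simp
  have "Q p = Q q"
    unfolding Q_const[of p] Q_const[of q] ..
  moreover have "Q q \<noteq> 0"
    using A(3) unfolding Q(2) by simp
  moreover have "H p \<noteq> 0"
    using dvd[of 0] A(1) unfolding homogeneous_dvd_def by auto
  ultimately show False
    using A(2) unfolding Q(2) by simp
qed

section \<open>The inverse built from three pencils of planes\<close>

context
  fixes \<sigma> \<tau> \<upsilon> :: "2 \<Rightarrow> complex ^ 4" and \<alpha> \<beta> \<gamma> :: "2 \<Rightarrow> complex" and W
  assumes W: "\<And>i j k. W i j k = (\<alpha> i * \<beta> j * \<gamma> k) *s wedge (\<sigma> i) (\<tau> j) (\<upsilon> k)"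
    and nonzero: "\<And>i. \<alpha> i \<noteq> 0" "\<And>j. \<beta> j \<noteq> 0" "\<And>k. \<gamma> k \<noteq> 0"
    and opposite: "\<And>i i' j k. i \<noteq> i' \<Longrightarrow> \<sigma> i' \<odot> wedge (\<sigma> i) (\<tau> j) (\<upsilon> k) \<noteq> 0"
      "\<And>i j j' k. j \<noteq> j' \<Longrightarrow> \<tau> j' \<odot> wedge (\<sigma> i) (\<tau> j) (\<upsilon> k) \<noteq> 0"
      "\<And>i j k k'. k \<noteq> k' \<Longrightarrow> \<upsilon> k' \<odot> wedge (\<sigma> i) (\<tau> j) (\<upsilon> k) \<noteq> 0"
begin

private abbreviation "f \<equiv> trilinear W"
private abbreviation "A \<equiv> parameter \<alpha> \<sigma>"
private abbreviation "B \<equiv> parameter \<beta> \<tau>"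
private abbreviation "C \<equiv> parameter \<gamma> \<upsilon>"

private lemma f_eq: "f s t u = wedge (pencil \<alpha> \<sigma> s) (pencil \<beta> \<tau> t) (pencil \<gamma> \<upsilon> u)"
  unfolding trilinear_eq_wedge_pencil[symmetric] W[abs_def] ..

private lemma parameters_f: "\<exists>r. A (f s t u) = r *s s" "\<exists>r. B (f s t u) = r *s t" "\<exists>r. C (f s t u) = r *s u"
proof -
  show "\<exists>r. A (f s t u) = r *s s"
    unfolding f_eq parameter_wedge_pencil by blast
  show "\<exists>r. B (f s t u) = r *s t"
    unfolding f_eq wedge_cyclic[symmetric, of "pencil \<alpha> \<sigma> s"] parameter_wedge_pencil by blast
  show "\<exists>r. C (f s t u) = r *s u"
    unfolding f_eq wedge_cyclic[of "pencil \<alpha> \<sigma> s" "pencil \<beta> \<tau> t" "pencil \<gamma> \<upsilon> u"] parameter_wedge_pencil by blast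
qed

text \<open>The vertex \<open>W 0 0 0\<close> witnesses that both open sets of the inverse are
  nonempty.\<close>

private lemma coordinate_at_vertex:
  "A (W 0 0 0) $ 0 \<noteq> 0" "B (W 0 0 0) $ 0 \<noteq> 0" "C (W 0 0 0) $ 0 \<noteq> 0"
  using nonzero opposite
  by (simp_all add: W parameter_def parameter_form_def scalar_product_linear scalar_product_minus)

private lemma coprime_pairs: "coprime_pair 1 A" "coprime_pair 1 B" "coprime_pair 1 C"
proof -
  let ?w = "\<lambda>i j k. wedge (\<sigma> i) (\<tau> j) (\<upsilon> k)"
  show "coprime_pair 1 A"
    by (rule coprime_pair_parameter[where p = "?w 0 0 0" and q = "?w 1 0 0"])
       (simp_all add: nonzero opposite wedge_orthogonal)
  show "coprime_pair 1 B"
    by (rule coprime_pair_parameter[where p = "?w 0 0 0" and q = "?w 0 1 0"])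
       (simp_all add: nonzero opposite wedge_orthogonal)
  show "coprime_pair 1 C"
    by (rule coprime_pair_parameter[where p = "?w 0 0 0" and q = "?w 0 0 1"])
       (simp_all add: nonzero opposite wedge_orthogonal)
qed

text \<open>One nonzero coordinate in each pair makes the three parameters nonzero, and also
  \<open>f s t u\<close>, because the pairs are linear in it.\<close>

private lemma zariski_open3_nonzero:
  "zariski_open3 {(s, t, u). s \<noteq> 0 \<and> t \<noteq> 0 \<and> u \<noteq> 0 \<and>
    A (f s t u) $ 0 * B (f s t u) $ 0 * C (f s t u) $ 0 \<noteq> 0}"
proof -
  define G where "G s t u = A (f s t u) $ 0 * B (f s t u) $ 0 * C (f s t u) $ 0" for s t u
  have "trihomogeneous_poly (1 + 1 + 1) (1 + 1 + 1) (1 + 1 + 1) G"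
    unfolding G_def[abs_def] parameter_def vec_lambda_beta
    by (rule trihomogeneous_poly_mult[OF trihomogeneous_poly_mult])
       (rule trihomogeneous_poly_scalar_product_trilinear)+
  then have "zariski_open3 {(s, t, u). s \<noteq> 0 \<and> t \<noteq> 0 \<and> u \<noteq> 0 \<and> (\<exists>G\<in>{G}. G s t u \<noteq> 0)}"
    unfolding zariski_open3_def by (intro exI[of _ "{G}"] conjI ballI refl) auto
  then show ?thesis
    by (simp add: G_def)
qed

private lemma zariski_open_composition_nonzero: "zariski_open {x. x \<noteq> 0 \<and> f (A x) (B x) (C x) \<noteq> 0}"
proof -
  define F where "F m x = f (A x) (B x) (C x) $ m" for m x
  have "homogeneous_poly 3 (F m)" for m
    unfolding F_def[abs_def] parameter_def by (rule homogeneous_poly_trilinear)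
  then have "zariski_closed {x. x \<noteq> 0 \<and> (\<forall>G\<in>range F. G x = 0)}"
    unfolding zariski_closed_def by (intro exI[of _ "range F"] conjI ballI refl) auto
  moreover have "(\<forall>G\<in>range F. G x = 0) \<longleftrightarrow> f (A x) (B x) (C x) = 0" for x
    unfolding vec_eq_iff[of "f (A x) (B x) (C x)"] by (simp add: F_def)
  then have "{x. x \<noteq> 0 \<and> f (A x) (B x) (C x) \<noteq> 0} = - {0} - {x. x \<noteq> 0 \<and> (\<forall>G\<in>range F. G x = 0)}"
    by auto
  ultimately show ?thesis
    unfolding zariski_open_def by blast
qed

private lemma rational_inverse_parameter: "rational_inverse f A B C"
  unfolding rational_inverse_def
proof (intro conjI exI)
  let ?e = "axis 0 1 :: complex ^ 2"
  let ?U = "{(s, t, u). s \<noteq> 0 \<and> t \<noteq> 0 \<and> u \<noteq> 0 \<and>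
    A (f s t u) $ 0 * B (f s t u) $ 0 * C (f s t u) $ 0 \<noteq> 0}"
  show "zariski_open3 ?U"
    by (rule zariski_open3_nonzero)
  have "(?e, ?e, ?e) \<in> ?U"
    using coordinate_at_vertex unfolding mem_Collect_eq case_prod_conv trilinear_vertex
    by (simp add: axis_eq_0_iff)
  then show "?U \<noteq> {}" by blast
  have "f s t u \<noteq> 0 \<and> proj_eq s (A (f s t u)) \<and> proj_eq t (B (f s t u)) \<and> proj_eq u (C (f s t u))"
    if "(s, t, u) \<in> ?U" for s t u
  proof -
    have stu: "s \<noteq> 0" "t \<noteq> 0" "u \<noteq> 0"
      and nz: "A (f s t u) $ 0 \<noteq> 0" "B (f s t u) $ 0 \<noteq> 0" "C (f s t u) $ 0 \<noteq> 0"
      using that by auto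
    have "A (f s t u) \<noteq> 0" "B (f s t u) \<noteq> 0" "C (f s t u) \<noteq> 0"
      using nz by auto
    moreover have "f s t u \<noteq> 0"
    proof
      assume "f s t u = 0"
      then show False
        using nz(1) by (simp add: parameter_def scalar_product_linear)
    qed
    ultimately show ?thesis
      unfolding proj_eq_def using parameters_f stu by blast
  qed
  then show "\<forall>(s, t, u)\<in>?U. f s t u \<noteq> 0 \<and>
      proj_eq s (A (f s t u)) \<and> proj_eq t (B (f s t u)) \<and> proj_eq u (C (f s t u))"
    by blast
next
  let ?e = "axis 0 1 :: complex ^ 2"
  let ?h = "\<lambda>x. f (A x) (B x) (C x)"
  let ?V = "{x. x \<noteq> 0 \<and> ?h x \<noteq> 0}"
  show "zariski_open ?V"
    by (rule zariski_open_composition_nonzero)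
  obtain x y z where xyz: "A (W 0 0 0) = x *s ?e" "B (W 0 0 0) = y *s ?e" "C (W 0 0 0) = z *s ?e"
    using parameters_f[of ?e ?e ?e] unfolding trilinear_vertex by blast
  have "x \<noteq> 0" "y \<noteq> 0" "z \<noteq> 0"
    using coordinate_at_vertex unfolding xyz by auto
  moreover have "W 0 0 0 \<noteq> 0"
  proof
    assume "W 0 0 0 = 0"
    then show False
      using coordinate_at_vertex(1) by (simp add: parameter_def scalar_product_linear)
  qed
  \<comment> \<open>By trilinear scaling the composition sends \<open>W 0 0 0\<close> to
    \<open>x * y * z\<close> times itself.\<close>
  ultimately have "W 0 0 0 \<in> ?V"
    unfolding mem_Collect_eq xyz trilinear_scale trilinear_vertex by simp
  then show "?V \<noteq> {}" by blast
  have "A x \<noteq> 0 \<and> B x \<noteq> 0 \<and> C x \<noteq> 0 \<and> proj_eq x (?h x)" if nz: "x \<noteq> 0" "?h x \<noteq> 0" for x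
  proof -
    have "A x \<noteq> 0 \<and> B x \<noteq> 0 \<and> C x \<noteq> 0"
      using nz(2) by (auto simp: trilinear_def)
    moreover obtain n where n: "x $ n \<noteq> 0"
      using nz(1) by (metis vec_eq_iff zero_index)
    \<comment> \<open>\<open>?h x\<close> is the wedge of three pencil members that all pass through
      \<open>x\<close>.\<close>
    have "x $ n *s ?h x = ?h x $ n *s x"
      unfolding f_eq by (intro wedge_collinear pencil_parameter)
    then have "?h x = (?h x $ n / x $ n) *s x"
      using n by (simp add: vec_eq_iff field_simps)
    ultimately show ?thesis
      using nz unfolding proj_eq_def by blast
  qed
  then show "\<forall>x\<in>?V. A x \<noteq> 0 \<and> B x \<noteq> 0 \<and> C x \<noteq> 0 \<and> proj_eq x (?h x)"
    by blast
qed

lemma birational_of_product_weights: "birational_of_type f (1, 1, 1)"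
  unfolding birational_of_type_def using coprime_pairs rational_inverse_parameter by blast

end

section \<open>Both directions of the equivalence\<close>

context hexahedral_map
begin

lemma product_of_birational:
  assumes "birational_of_type (trilinear_map w P) (1, 1, 1)"
  shows "\<exists>\<alpha> \<beta> \<gamma> :: real ^ 2. \<alpha> \<noteq> 0 \<and> \<beta> \<noteq> 0 \<and> \<gamma> \<noteq> 0 \<and> (\<forall>i j k. v i j k = \<alpha> $ i * \<beta> $ j * \<gamma> $ k)"
proof -
  obtain A B C where coprime: "coprime_pair 1 A" "coprime_pair 1 B" "coprime_pair 1 C"
    and inverse: "rational_inverse (trilinear W) A B C"
    using assms unfolding birational_of_type_def trilinear_map_eq by blast
  obtain a where a: "\<And>x i. A x $ i = a i \<odot> x" using coprime_pair_1_linear[OF coprime(1)] by blast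
  obtain b where b: "\<And>x i. B x $ i = b i \<odot> x" using coprime_pair_1_linear[OF coprime(2)] by blast
  obtain c where c: "\<And>x i. C x $ i = c i \<odot> x" using coprime_pair_1_linear[OF coprime(3)] by blast
  obtain U where U: "zariski_open3 U" "U \<noteq> {}" and *: "\<forall>(s, t, u)\<in>U. trilinear W s t u \<noteq> 0 \<and>
      proj_eq s (A (trilinear W s t u)) \<and> proj_eq t (B (trilinear W s t u)) \<and>
      proj_eq u (C (trilinear W s t u))"
    using inverse unfolding rational_inverse_def by blast
  have inv: "proj_eq s (A (trilinear W s t u))" "proj_eq t (B (trilinear W s t u))"
    "proj_eq u (C (trilinear W s t u))" if "(s, t, u) \<in> U" for s t u
    using * that by blast+
  let ?v = "\<lambda>i j k. complex_of_real (v i j k)"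
  \<comment> \<open>The ratio obtained from the complex inverse is complex; for real weights its
    real part serves equally well.\<close>
  have real_ratio: "x = Re r * y" if "complex_of_real x = r * complex_of_real y" for x y r
    using arg_cong[OF that, of Re] by simp
  obtain x1 where x1: "a 0 \<odot> x1 \<noteq> 0 \<or> a 1 \<odot> x1 \<noteq> 0"
    using inverse_identity(2)[OF U trihomogeneous_poly_coordinate(1) a inv(1)] by blast
  have "\<exists>r. \<forall>j k. ?v 1 j k = r * ?v 0 j k"
  proof (rule weights_proportional[OF W_eq_wedge _ _ _ _ x1])
    show "s $ 1 * (a 0 \<odot> trilinear W s t u) = s $ 0 * (a 1 \<odot> trilinear W s t u)" for s t u
      by (rule inverse_identity(1)[OF U trihomogeneous_poly_coordinate(1) a inv(1)])
    show "p \<odot> x = 0" if "\<And>j k. p \<odot> W i j k = 0" "S i \<odot> x = 0" for i p x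
      using that by (rule surface_spanned(1))
  qed (simp_all add: v_nonzero opposite_nonzero)
  then obtain r1 where "\<And>j k. ?v 1 j k = r1 * ?v 0 j k" by blast
  then have 1: "v 1 j k = Re r1 * v 0 j k" for j k
    by (rule real_ratio)
  obtain x2 where x2: "b 0 \<odot> x2 \<noteq> 0 \<or> b 1 \<odot> x2 \<noteq> 0"
    using inverse_identity(2)[OF U trihomogeneous_poly_coordinate(2) b inv(2)] by blast
  have "\<exists>r. \<forall>k i. ?v i 1 k = r * ?v i 0 k"
  \<comment> \<open>The three factors are rotated so that the second parameter comes first; the
    wedge is invariant under this rotation.\<close>
  proof (rule weights_proportional[where W = "\<lambda>j k i. W i j k" and \<sigma> = T and \<tau> = Y and \<upsilon> = S, OF _ _ _ _ _ x2])
    show "t $ 1 * (b 0 \<odot> trilinear (\<lambda>j k i. W i j k) t u s) =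
        t $ 0 * (b 1 \<odot> trilinear (\<lambda>j k i. W i j k) t u s)" for s t u
      unfolding trilinear_cyclic[of W t u s]
      by (rule inverse_identity(1)[OF U trihomogeneous_poly_coordinate(2) b inv(2)])
    show "p \<odot> x = 0" if "\<And>k i. p \<odot> W i j k = 0" "T j \<odot> x = 0" for j p x
      using that by (rule surface_spanned(2))
    show "W i j k = ?v i j k *s wedge (T j) (Y k) (S i)" for i j k
      unfolding W_eq_wedge wedge_cyclic[of "T j" "Y k" "S i"] ..
    show "T 1 \<odot> wedge (T 0) (Y k) (S i) \<noteq> 0" for i k
      unfolding wedge_cyclic[of "T 0" "Y k" "S i"] by (simp add: opposite_nonzero)
  qed (simp add: v_nonzero)
  then obtain r2 where "\<And>k i. ?v i 1 k = r2 * ?v i 0 k" by blast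
  then have 2: "v i 1 k = Re r2 * v i 0 k" for i k
    by (rule real_ratio)
  obtain x3 where x3: "c 0 \<odot> x3 \<noteq> 0 \<or> c 1 \<odot> x3 \<noteq> 0"
    using inverse_identity(2)[OF U trihomogeneous_poly_coordinate(3) c inv(3)] by blast
  have "\<exists>r. \<forall>i j. ?v i j 1 = r * ?v i j 0"
  proof (rule weights_proportional[where W = "\<lambda>k i j. W i j k" and \<sigma> = Y and \<tau> = S and \<upsilon> = T, OF _ _ _ _ _ x3])
    show "u $ 1 * (c 0 \<odot> trilinear (\<lambda>k i j. W i j k) u s t) =
        u $ 0 * (c 1 \<odot> trilinear (\<lambda>k i j. W i j k) u s t)" for s t u
      \<comment> \<open>Two rotations bring the third parameter to the front.\<close>
      unfolding trilinear_cyclic[of "\<lambda>j k i. W i j k" u s t] trilinear_cyclic[of W t u s]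
      by (rule inverse_identity(1)[OF U trihomogeneous_poly_coordinate(3) c inv(3)])
    show "p \<odot> x = 0" if "\<And>i j. p \<odot> W i j k = 0" "Y k \<odot> x = 0" for k p x
      using that by (rule surface_spanned(3))
    show "W i j k = ?v i j k *s wedge (Y k) (S i) (T j)" for i j k
      unfolding W_eq_wedge wedge_cyclic[of "S i" "T j" "Y k", symmetric] ..
    show "Y 1 \<odot> wedge (Y 0) (S i) (T j) \<noteq> 0" for i j
      unfolding wedge_cyclic[of "S i" "T j" "Y 0", symmetric] by (simp add: opposite_nonzero)
  qed (simp add: v_nonzero)
  then obtain r3 where "\<And>i j. ?v i j 1 = r3 * ?v i j 0" by blast
  then have 3: "v i j 1 = Re r3 * v i j 0" for i j
    by (rule real_ratio)
  show ?thesis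
    by (rule product_of_proportional[OF 1 2 3 v_nonzero])
qed

lemma birational_of_product:
  assumes "\<And>i j k. v i j k = \<alpha> i * \<beta> j * \<gamma> k"
  shows "birational_of_type (trilinear_map w P) (1, 1, 1)"
  unfolding trilinear_map_eq
proof (rule birational_of_product_weights)
  show "W i j k = (complex_of_real (\<alpha> i) * complex_of_real (\<beta> j) * complex_of_real (\<gamma> k)) *s
      wedge (S i) (T j) (Y k)" for i j k
    by (simp add: W_eq_wedge assms)
  \<comment> \<open>No entry of the three pairs can vanish, since every product
    \<open>v i j k\<close> is nonzero.\<close>
  have "\<alpha> i \<noteq> 0 \<and> \<beta> j \<noteq> 0 \<and> \<gamma> k \<noteq> 0" for i j k
    using v_nonzero[of i j k] unfolding assms by auto
  then show "complex_of_real (\<alpha> i) \<noteq> 0" "complex_of_real (\<beta> i) \<noteq> 0" "complex_of_real (\<gamma> i) \<noteq> 0" for i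
    by auto
qed (simp_all add: opposite_nonzero)

end

theorem corollary3p6:
  fixes w :: "2 \<Rightarrow> 2 \<Rightarrow> 2 \<Rightarrow> real"
    and P :: "2 \<Rightarrow> 2 \<Rightarrow> 2 \<Rightarrow> real ^ 4"
    and \<sigma> \<tau> \<upsilon> :: "2 \<Rightarrow> real ^ 4"
  assumes control_points: "\<And>i j k. P i j k $ 0 = 1"
    and nondeg: "nondegenerate w P"
    and hexa: "hexahedral w P"
    and sigma: "\<And>i. Sigma_surface w P i = plane_of (\<sigma> i)"
    and tau: "\<And>j. T_surface w P j = plane_of (\<tau> j)"
    and upsilon: "\<And>k. Y_surface w P k = plane_of (\<upsilon> k)"
  shows "birational_of_type (trilinear_map w P) (1, 1, 1) \<longleftrightarrow>
    (\<exists>\<alpha> \<beta> \<gamma> :: real ^ 2. \<alpha> \<noteq> 0 \<and> \<beta> \<noteq> 0 \<and> \<gamma> \<noteq> 0 \<and>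
       (\<forall>i j k. w i j k = \<alpha> $ i * \<beta> $ j * \<gamma> $ k * Delta (\<sigma> i) (\<tau> j) (\<upsilon> k)))"
proof -
  interpret hexahedral_map w P \<sigma> \<tau> \<upsilon>
    using assms by unfold_locales
  \<comment> \<open>Division by the nonzero Delta reduces the condition on the weights to the
    product form of \<open>v\<close>.\<close>
  have weights: "w i j k = x * Delta (\<sigma> i) (\<tau> j) (\<upsilon> k) \<longleftrightarrow> v i j k = x" for i j k x
    using Delta_nonzero[of i j k] by (simp add: v_def field_simps)
  show ?thesis
    unfolding weights
  proof
    assume "\<exists>\<alpha> \<beta> \<gamma> :: real ^ 2. \<alpha> \<noteq> 0 \<and> \<beta> \<noteq> 0 \<and> \<gamma> \<noteq> 0 \<and>
      (\<forall>i j k. v i j k = \<alpha> $ i * \<beta> $ j * \<gamma> $ k)"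
    then obtain \<alpha> \<beta> \<gamma> :: "real ^ 2" where "\<And>i j k. v i j k = \<alpha> $ i * \<beta> $ j * \<gamma> $ k"
      by blast
    then show "birational_of_type (trilinear_map w P) (1, 1, 1)"
      by (rule birational_of_product)
  qed (rule product_of_birational)
qed

end
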